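(* Let $k$ be a perfect field, $p\in k[x]$ an irreducible polynomial and $T=p^e\in k[x]$ a power of $p$ ($T$ monic, non-constant). Let $a,b\in k[x,y]$ be polynomials with $\deg_y(a)\ge \deg_y(b)$, such that the leading coefficient of $a$ (as a polynomial in $y$) is invertible modulo $T$, and $b$ is not nilpotent modulo $T$ (in particular $b\neq 0$). Then the output $\mathcal{G}$ of the algorithm $\mathtt{SubresToGB}(a,b,T)$ (described in the context) is a minimal lexicographic Gröbner basis of the ideal $\langle a, b, T\rangle$ of $k[x,y]$.
   Context: Conventions. $R=k[x]/\langle T\rangle$; input polynomials are taken reduced modulo $T$. Monomials of $k[x,y]$ are ordered by the lexicographic order with $x\prec y$: $x^{\alpha}y^{\beta}\prec x^{\gamma}y^{\delta}$ iff $\beta<\delta$, or $\beta=\delta$ and $\alpha<\gamma$. A lexicographic Gröbner basis $(g_1,\dots,g_s)$ (with leading coefficients $1$) is minimal if no leading monomial of $g_i$ is divisible by the leading monomial of some $g_j$, $j\ne i$. $\mathrm{lc}(f)$ is the leading coefficient of $f$ with respect to $y$; "monic" for an element of $k[x,y]$ means monic in $y$. A polynomial is nilpotent modulo $T=p^e$ if $p$ divides all its coefficients; $0$ is counted as nilpotent. $\mathrm{prem}(A,B)$ denotes the pseudo-remainder in $y$: $\mathrm{lc}(B)^{\deg A-\deg B+1}A=qB+\mathrm{prem}(A,B)$ with $\deg_y \mathrm{prem}(A,B)<\deg_y B$. Subresultant p.r.s. modulo $T$ of $f_1,f_2$ (with $\deg_y f_1\ge\deg_y f_2$): computed in $R[y]$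 by, with $n_j=\deg_y f_j$, $f_3=(-1)^{n_1-n_2+1}\mathrm{prem}(f_1,f_2)$, $c_3=-1$, and for $i\ge4$: $c_i=\left(\frac{\mathrm{lc}(f_{i-2})}{c_{i-1}}\right)^{n_{i-3}-n_{i-2}}c_{i-1}$ and $f_i=\dfrac{\mathrm{prem}(f_{i-2},f_{i-1})}{-\mathrm{lc}(f_{i-2})(-c_i)^{n_{i-2}-n_{i-1}}}$. It is computed until the first $f_i$ whose leading coefficient is not invertible modulo $T$, or until $f_{\ell+1}=0$. $\mathtt{MonicForm}(f,T)$, $T=p^e$: let $U$ be the monic gcd of $T$ and all coefficients (in $k[x]$) of $f$; put $f'=f/U$, $T'=T/U$. Let $d$ be the largest index such that the coefficient $c_d$ of $y^d$ in $f'$ is invertible modulo $T'$, $\alpha$ its inverse modulo $T'$, and $N$ the gcd of $T'$ with all coefficients of $f'$ of degree in $y$ larger than $d$ ($N=T'$ if there are none). Let $b_0=\alpha f' \bmod N$ (monic of degree $d$). By quadratic Hensel lifting (starting with the factorization $f'\equiv c_d b_0 \bmod N$ and the Bézout identity $\alpha c_d+0\cdot b_0\equiv1$), compute $c^\star\equiv c_d$, $b^\star\equiv b_0 \pmod N$ with $b^\star$ monic of degree $d$ and $f'\equiv c^\star b^\star \bmod N^{2^\epsilon}$, where $\epsilon$ is the smallest integer with $T'\mid N^{2^\epsilon}$. Return $(b^\star \bmod T',\ U)$. $\mathtt{LastNonNil}(f_1,f_2,T)$ (with $\mathrm{lc}(f_1)$ invertible modulo $T$, $f_2\ne0$, $\deg_y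 f_1\ge\deg_y f_2$): compute the subresultant p.r.s. of $f_1,f_2$ modulo $T$. If some $\mathrm{lc}(f_i)$ is not invertible modulo $T$ (take the first such $i$): let $(b,U)=\mathtt{MonicForm}(f_i,T)$ and $a=\mathrm{lc}(f_{i-1})^{-1}f_{i-1}\bmod T$; if $\deg_x(U)>0$ return $(a,b,U,T/U)$, else return $\mathtt{LastNonNil}(a,b,T)$. Otherwise all of $\mathrm{lc}(f_1),\dots,\mathrm{lc}(f_\ell)$ are invertible and $f_{\ell+1}=0$: return $(\mathrm{lc}(f_\ell)^{-1}f_\ell \bmod T,\ 0,\ 1,\ T)$. $\mathtt{SubresToGB}(a,b,T)$: 1. If $a$ or $b$ is a non-zero constant, return $[1]$. 2. Let $(u,v,U,T_1)=\mathtt{LastNonNil}(a,b,T)$. 3. If $u=1$, return $[1]$. 4. If $v=0$, return $[u,T]$. 5. Let $\mathcal{G}_1=\mathtt{SubresToGB}(u,v,T_1)$ (recursive call) and return $\mathcal{G}$, the list consisting of $u$ and of all $U\cdot g$ for $g\in\mathcal{G}_1$. *)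

theory Defs
  imports "HOL-Computational_Algebra.Polynomial"
begin

text \<open>
  The ring \<open>k[x,y]\<close> is the type \<open>'a poly poly\<close>: the outer variable is \<open>y\<close>, the inner one is \<open>x\<close>.
  Thus \<^const>\<open>degree\<close> and \<^const>\<open>lead_coeff\<close> of an element of \<open>k[x,y]\<close> are those with respect to \<open>y\<close>.
\<close>

definition perfect_field :: "'a::field itself \<Rightarrow> bool" where
  "perfect_field _ \<longleftrightarrow> (\<forall>q::'a poly. irreducible q \<longrightarrow> coprime q (pderiv q))"

definition ideal :: "'a::comm_ring_1 set \<Rightarrow> 'a set" where
  "ideal S = module.span (*) S"

lemma module_mult: "module ((*) :: 'a::comm_ring_1 \<Rightarrow> 'a \<Rightarrow> 'a)"
  by unfold_locales (simp_all add: algebra_simps)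


section \<open>Lexicographic Groebner bases\<close>

text \<open>The exponent \<open>(\<alpha>, \<beta>)\<close> stands for the monomial \<open>x^\<alpha> y^\<beta>\<close>.\<close>

definition support :: "'a::zero poly poly \<Rightarrow> (nat \<times> nat) set" where
  "support f = {(\<alpha>, \<beta>). coeff (coeff f \<beta>) \<alpha> \<noteq> 0}"

definition lex_less :: "nat \<times> nat \<Rightarrow> nat \<times> nat \<Rightarrow> bool" where
  "lex_less = (\<lambda>(\<alpha>, \<beta>) (\<gamma>, \<delta>). \<beta> < \<delta> \<or> \<beta> = \<delta> \<and> \<alpha> < \<gamma>)"

definition lead_exp :: "'a::zero poly poly \<Rightarrow> nat \<times> nat" where
  "lead_exp f = (THE m. m \<in> support f \<and> (\<forall>m' \<in> support f. m' \<noteq> m \<longrightarrow> lex_less m' m))"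

lemma lead_exp_eq:
  assumes "f \<noteq> 0"
  shows "lead_exp f = (degree (lead_coeff f), degree f)"
  unfolding lead_exp_def
proof (rule the_equality)
  have "lead_coeff f \<noteq> 0"
    using assms by simp
  then have mem: "(degree (lead_coeff f), degree f) \<in> support f"
    unfolding support_def by (simp del: leading_coeff_0_iff) (simp add: assms)
  have max: "lex_less m (degree (lead_coeff f), degree f)"
    if "m \<in> support f" "m \<noteq> (degree (lead_coeff f), degree f)" for m
  proof -
    obtain \<alpha> \<beta> where m: "m = (\<alpha>, \<beta>)"
      by (cases m)
    then have nz: "coeff (coeff f \<beta>) \<alpha> \<noteq> 0"
      using that(1) by (simp add: support_def)
    then have "\<beta> \<le> degree f"
      by (metis coeff_0 le_degree)
    moreover from nz have "\<alpha> \<le> degree (coeff f \<beta>)"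
      by (rule le_degree)
    ultimately show ?thesis
      using that(2) m by (cases "\<beta> = degree f") (auto simp: lex_less_def)
  qed
  show "(degree (lead_coeff f), degree f) \<in> support f \<and>
    (\<forall>m'\<in>support f. m' \<noteq> (degree (lead_coeff f), degree f) \<longrightarrow>
       lex_less m' (degree (lead_coeff f), degree f))"
    using mem max by blast
  show "m = (degree (lead_coeff f), degree f)"
    if m: "m \<in> support f \<and> (\<forall>m'\<in>support f. m' \<noteq> m \<longrightarrow> lex_less m' m)" for m
  proof (rule ccontr)
    assume ne: "m \<noteq> (degree (lead_coeff f), degree f)"
    with m mem have "lex_less (degree (lead_coeff f), degree f) m"
      by metis
    moreover from m max ne have "lex_less m (degree (lead_coeff f), degree f)"
      by blast
    ultimately show False
      by (cases m) (auto simp: lex_less_def)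
  qed
qed

definition lead_monom :: "'a::zero_neq_one poly poly \<Rightarrow> 'a poly poly" where
  "lead_monom f = (case lead_exp f of (\<alpha>, \<beta>) \<Rightarrow> monom (monom 1 \<alpha>) \<beta>)"

definition lex_lead_coeff :: "'a::zero poly poly \<Rightarrow> 'a" where
  "lex_lead_coeff f = (case lead_exp f of (\<alpha>, \<beta>) \<Rightarrow> coeff (coeff f \<beta>) \<alpha>)"

definition lex_groebner_basis :: "'a::field poly poly set \<Rightarrow> 'a poly poly set \<Rightarrow> bool" where
  "lex_groebner_basis G I \<longleftrightarrow>
     finite G \<and> G \<subseteq> I \<and> ideal (lead_monom ` (G - {0})) = ideal (lead_monom ` (I - {0}))"

definition minimal_lex_groebner_basis ::
  "'a::field poly poly list \<Rightarrow> 'a poly poly set \<Rightarrow> bool" where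
  "minimal_lex_groebner_basis gs I \<longleftrightarrow>
     lex_groebner_basis (set gs) I \<and>
     (\<forall>g \<in> set gs. g \<noteq> 0 \<and> lex_lead_coeff g = 1) \<and>
     (\<forall>i < length gs. \<forall>j < length gs.
        j \<noteq> i \<longrightarrow> \<not> lead_monom (gs ! j) dvd lead_monom (gs ! i))"


section \<open>Computing modulo a univariate polynomial\<close>

text \<open>Elements of \<open>(k[x]/\<langle>T\<rangle>)[y]\<close> are represented by their reduced representatives in \<open>k[x,y]\<close>.\<close>

definition reduce :: "'a::field poly \<Rightarrow> 'a poly poly \<Rightarrow> 'a poly poly" where
  "reduce T f = map_poly (\<lambda>c. c mod T) f"

definition invertible_mod :: "'a::field poly \<Rightarrow> 'a poly \<Rightarrow> bool" where
  "invertible_mod T c \<longleftrightarrow> (\<exists>w. (c * w) mod T = 1 mod T)"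

definition inverse_mod :: "'a::field poly \<Rightarrow> 'a poly \<Rightarrow> 'a poly" where
  "inverse_mod T c = (SOME w. (c * w) mod T = 1 mod T) mod T"

definition make_monic_mod :: "'a::field poly \<Rightarrow> 'a poly poly \<Rightarrow> 'a poly poly" where
  "make_monic_mod T f = reduce T (smult (inverse_mod T (lead_coeff f)) f)"

definition nilpotent_mod :: "'a::field poly \<Rightarrow> 'a poly poly \<Rightarrow> bool" where
  "nilpotent_mod p f \<longleftrightarrow> (\<forall>i. p dvd coeff f i)"

text \<open>The library provides \<open>gcd\<close> on \<open>'a poly\<close> only for a subclass of fields.\<close>

definition monic_gcd :: "'a::field poly set \<Rightarrow> 'a poly" where
  "monic_gcd S = (THE g. lead_coeff g = 1 \<and> (\<forall>s\<in>S. g dvd s) \<and>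
     (\<forall>h. (\<forall>s\<in>S. h dvd s) \<longrightarrow> h dvd g))"


section \<open>Subresultant pseudo-remainder sequence\<close>

text \<open>
  \<open>subres T f1 f2 i\<close> and \<open>subres_c T f1 f2 i\<close> are \<open>f\<^sub>i\<close> (\<open>i \<ge> 1\<close>) and \<open>c\<^sub>i\<close> (\<open>i \<ge> 3\<close>);
  the values at smaller indices are irrelevant, as are those after the first index
  where the leading coefficient is not invertible (see \<open>subres_stop\<close>).
\<close>

function subres :: "'a::field poly \<Rightarrow> 'a poly poly \<Rightarrow> 'a poly poly \<Rightarrow> nat \<Rightarrow> 'a poly poly"
  and subres_c :: "'a poly \<Rightarrow> 'a poly poly \<Rightarrow> 'a poly poly \<Rightarrow> nat \<Rightarrow> 'a poly"
where
  "subres T f1 f2 i =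
    (if i \<le> 1 then f1
     else if i = 2 then f2
     else if i = 3 then
       reduce T ((-1) ^ (degree f1 - degree f2 + 1) * pseudo_mod f1 f2)
     else
       (let A = subres T f1 f2 (i - 2);
            B = subres T f1 f2 (i - 1);
            c = subres_c T f1 f2 i
        in reduce T (smult
             (inverse_mod T (- lead_coeff A * (- c) ^ (degree A - degree B)))
             (pseudo_mod A B))))"
| "subres_c T f1 f2 i =
    (if i \<le> 3 then -1
     else
       (let l = lead_coeff (subres T f1 f2 (i - 2));
            c = subres_c T f1 f2 (i - 1);
            \<delta> = degree (subres T f1 f2 (i - 3)) - degree (subres T f1 f2 (i - 2))
        in ((l * inverse_mod T c) ^ \<delta> * c) mod T))"
  by pat_completeness auto
termination
  by (relation "measure (case_sum (\<lambda>(T, f1, f2, i). 2 * i + 1) (\<lambda>(T, f1, f2, i). 2 * i))") auto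

declare subres.simps [simp del] subres_c.simps [simp del]

text \<open>
  The index at which the computation stops. Since \<open>0\<close> is not invertible modulo a non-constant \<open>T\<close>,
  this covers both the first non-invertible leading coefficient and the case \<open>f\<^sub>i = 0\<close>.
\<close>

definition subres_stop :: "'a::field poly \<Rightarrow> 'a poly poly \<Rightarrow> 'a poly poly \<Rightarrow> nat" where
  "subres_stop T f1 f2 =
     (LEAST i. i \<ge> 2 \<and> \<not> invertible_mod T (lead_coeff (subres T f1 f2 i)))"


section \<open>Hensel lifting and \<open>MonicForm\<close>\<close>

text \<open>
  One step of quadratic Hensel lifting, from modulus \<open>m\<close> to modulus \<open>m\<^sup>2\<close>, for
  \<open>f \<equiv> g h\<close>, \<open>s g + t h \<equiv> 1 (mod m)\<close> with \<open>h\<close> monic in \<open>y\<close>.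
  Pseudo-division by a monic polynomial is ordinary division with remainder.
\<close>

definition hensel_step ::
  "'a::field poly \<Rightarrow> 'a poly poly \<Rightarrow>
   'a poly poly \<times> 'a poly poly \<times> 'a poly poly \<times> 'a poly poly \<Rightarrow>
   'a poly poly \<times> 'a poly poly \<times> 'a poly poly \<times> 'a poly poly" where
  "hensel_step m f = (\<lambda>(g, h, s, t).
     let R = reduce (m ^ 2);
         e = R (f - g * h);
         (q, r) = pseudo_divmod (R (s * e)) h;
         g' = R (g + t * e + q * g);
         h' = R (h + r);
         b = R (s * g' + t * h' - 1);
         (c, d) = pseudo_divmod (R (s * b)) h';
         s' = R (s - d);
         t' = R (t - t * b - c * g')
     in (g', h', s', t'))"

text \<open>The result of \<open>j\<close> steps, which is valid modulo \<open>N ^ (2 ^ j)\<close>.\<close>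

primrec hensel_lift ::
  "'a::field poly \<Rightarrow> 'a poly poly \<Rightarrow>
   'a poly poly \<times> 'a poly poly \<times> 'a poly poly \<times> 'a poly poly \<Rightarrow> nat \<Rightarrow>
   'a poly poly \<times> 'a poly poly \<times> 'a poly poly \<times> 'a poly poly" where
  "hensel_lift N f init 0 = init"
| "hensel_lift N f init (Suc j) = hensel_step (N ^ (2 ^ j)) f (hensel_lift N f init j)"

definition monic_form :: "'a::field poly poly \<Rightarrow> 'a poly \<Rightarrow> 'a poly poly \<times> 'a poly" where
  "monic_form f T =
    (let U = monic_gcd (insert T (range (coeff f)));
         f' = map_poly (\<lambda>c. c div U) f;
         T' = T div U;
         d = (GREATEST d. invertible_mod T' (coeff f' d));
         \<alpha> = inverse_mod T' (coeff f' d);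
         N = monic_gcd (insert T' {coeff f' j | j. j > d});
         b0 = reduce N (smult \<alpha> f');
         \<epsilon> = (LEAST \<epsilon>. T' dvd N ^ (2 ^ \<epsilon>));
         (c_star, b_star, _, _) = hensel_lift N f' ([:coeff f' d:], b0, [:\<alpha>:], 0) \<epsilon>
     in (reduce T' b_star, U))"


section \<open>The algorithms\<close>

text \<open>\<^const>\<open>None\<close> stands for non-termination, so a result \<open>Some r\<close> includes termination.\<close>

partial_function (option) last_non_nil ::
  "'a::field poly poly \<Rightarrow> 'a poly poly \<Rightarrow> 'a poly \<Rightarrow>
   ('a poly poly \<times> 'a poly poly \<times> 'a poly \<times> 'a poly) option" where
  "last_non_nil f1 f2 T =
    (let i = subres_stop T f1 f2;
         a = make_monic_mod T (subres T f1 f2 (i - 1));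
         fi = subres T f1 f2 i
     in if fi = 0 then Some (a, 0, 1, T)
        else let (b, U) = monic_form fi T
             in if degree U > 0 then Some (a, b, U, T div U)
                else last_non_nil a b T)"

definition nonzero_constant :: "'a::zero poly poly \<Rightarrow> bool" where
  "nonzero_constant f \<longleftrightarrow> (\<exists>c. c \<noteq> 0 \<and> f = [:[:c:]:])"

text \<open>
  Inputs are reduced modulo \<open>T\<close> first; \<open>last_non_nil\<close> is only called on reduced polynomials.
\<close>

partial_function (option) subres_to_gb ::
  "'a::field poly poly \<Rightarrow> 'a poly poly \<Rightarrow> 'a poly \<Rightarrow> 'a poly poly list option" where
  "subres_to_gb a0 b0 T =
    (let a = reduce T a0;
         b = reduce T b0
     in if nonzero_constant a \<or> nonzero_constant b then Some [1]
        else Option.bind (last_non_nil a b T) (\<lambda>(u, v, U, T1).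
          if u = 1 then Some [1]
          else if v = 0 then Some [u, [:T:]]
          else Option.bind (subres_to_gb u v T1) (\<lambda>gs. Some (u # map (smult U) gs))))"

end

theory Submission
  imports Defs
begin

text \<open>
  The algorithm rewrites the generators of \<open>\<langle>a, b, T\<rangle>\<close> without changing the ideal. As long
  as the leading coefficients of the remainder sequence are units modulo \<open>T\<close>, two consecutive
  remainders generate the same ideal together with \<open>T\<close> (\<open>subres_properties\<close>). When a remainder
  \<open>f\<close> has a leading coefficient that is not a unit, then modulo \<open>T\<close> it is associated to \<open>U v\<close>, where
  \<open>v\<close> is monic and \<open>U\<close> is the power of \<open>p\<close> common to \<open>T\<close> and all coefficients of \<open>f\<close> (\<open>monic_form_correct\<close>): after
  division by \<open>U\<close>, the part of \<open>f\<close> that is not nilpotent splits off as a monic factor by Hensel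
  lifting, and the cofactor is a unit modulo \<open>p\<close>, hence modulo \<open>T / U\<close>.

  If \<open>U = 1\<close>, the sequence is restarted with a second argument of smaller degree. Otherwise
  \<open>\<langle>a, b, T\<rangle> = \<langle>u\<rangle> + U J\<close> with \<open>u\<close> monic, \<open>T\<^sub>1 = T / U\<close> and \<open>J = \<langle>u, v, T\<^sub>1\<rangle>\<close>. This identity also gives the
  Groebner basis: a nonzero element of \<open>\<langle>u\<rangle> + U J\<close> either has at least the degree of \<open>u\<close> in \<open>y\<close>, so that its
  leading monomial is divisible by that of \<open>u\<close>, or reduction by \<open>u \<in> J\<close> shows that it is \<open>U\<close> times an
  element of \<open>J\<close>. So \<open>u\<close> together with \<open>U\<close> times a Groebner basis of \<open>J\<close> is a Groebner basis
  (\<open>staircase_basis_Cons\<close>). It is minimal because the basis of \<open>J\<close> has smaller degree in \<open>y\<close> than \<open>u\<close>: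
  the leading exponents form a strict staircase.

  The inner recursion terminates because the degree of the second argument drops, the outer one
  because the exponent of \<open>p\<close> in the modulus drops.
\<close>


section \<open>Invertibility modulo a polynomial\<close>

lemma dvd_diff_swap: "d dvd x - y \<Longrightarrow> d dvd y - x" for d :: "'r::comm_ring_1"
  by (metis dvd_minus_iff minus_diff_eq)

lemma invertible_mod_iff: "invertible_mod T c \<longleftrightarrow> (\<exists>w. T dvd c * w - 1)"
  unfolding invertible_mod_def by (simp add: mod_eq_dvd_iff)

lemma inverse_mod_dvd:
  assumes "invertible_mod T c"
  shows "T dvd c * inverse_mod T c - 1"
proof -
  define w where "w = (SOME w. (c * w) mod T = 1 mod T)"
  have "(c * w) mod T = 1 mod T"
    unfolding w_def using assms unfolding invertible_mod_def by (rule someI_ex)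
  then have "(c * (w mod T)) mod T = 1 mod T"
    by (simp add: mod_mult_right_eq)
  then show ?thesis
    unfolding inverse_mod_def w_def[symmetric] by (simp add: mod_eq_dvd_iff)
qed

lemma invertible_inverse_mod: "invertible_mod T c \<Longrightarrow> invertible_mod T (inverse_mod T c)"
  using inverse_mod_dvd[of T c] unfolding invertible_mod_iff
  by (metis mult.commute)

lemma invertible_mod_one: "invertible_mod T 1"
  unfolding invertible_mod_def by (intro exI[of _ 1]) simp

lemma invertible_mod_uminus: "invertible_mod T c \<Longrightarrow> invertible_mod T (- c)"
  unfolding invertible_mod_iff by (metis minus_mult_minus)

lemma invertible_mod_mult:
  assumes "invertible_mod T c" "invertible_mod T d"
  shows "invertible_mod T (c * d)"
proof -
  obtain v w where "(c * v) mod T = 1 mod T" "(d * w) mod T = 1 mod T"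
    using assms unfolding invertible_mod_def by blast
  then have "((c * v) * (d * w)) mod T = (1 * 1) mod T"
    by (rule mod_mult_cong)
  then have "((c * d) * (v * w)) mod T = 1 mod T"
    by (simp add: ac_simps)
  then show ?thesis
    unfolding invertible_mod_def by blast
qed

lemma invertible_mod_power: "invertible_mod T c \<Longrightarrow> invertible_mod T (c ^ n)"
  by (induction n) (auto simp: invertible_mod_one invertible_mod_mult)

lemma invertible_mod_mod: "invertible_mod T (c mod T) \<longleftrightarrow> invertible_mod T c"
  unfolding invertible_mod_def by (simp add: mod_mult_left_eq)

lemma not_invertible_mod_0: "0 < degree T \<Longrightarrow> \<not> invertible_mod T 0"
  unfolding invertible_mod_iff
  by (metis diff_0 dvd_minus_iff is_unit_iff_degree less_irrefl degree_0 mult_zero_left)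

text \<open>
  If \<open>1 - g w\<close> is a multiple of \<open>P\<close>, then \<open>(1 - g w) ^ k\<close> is a multiple of \<open>P ^ k\<close>, and it differs
  from \<open>1\<close> by a multiple of \<open>g\<close>. This is used both in \<open>k[x]\<close> and in \<open>k[x,y]\<close>.
\<close>
lemma inverse_modulo_power:
  fixes P g w :: "'r::comm_ring_1"
  assumes "P dvd g * w - 1"
  shows "\<exists>w'. P ^ k dvd g * w' - 1"
proof -
  have "P dvd 1 - g * w"
    using assms by (rule dvd_diff_swap)
  then have "P ^ k dvd (1 - g * w) ^ k"
    by (rule dvd_power_same)
  moreover have "1 - (1 - g * w) ^ k = g * (w * (\<Sum>i<k. (1 - g * w) ^ i))"
    using one_diff_power_eq[of "1 - g * w" k] by (simp add: mult.assoc)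
  ultimately have "P ^ k dvd g * (w * (\<Sum>i<k. (1 - g * w) ^ i)) - 1"
    by (metis diff_diff_eq2 add_diff_cancel_left' dvd_minus_iff minus_diff_eq)
  then show ?thesis by blast
qed

text \<open>
  A nonzero combination \<open>u c + v p\<close> of least degree divides both \<open>c\<close> and \<open>p\<close>; it is not associated
  to \<open>p\<close>, hence it is a unit.
\<close>
lemma irreducible_bezout:
  fixes p c :: "'a::field poly"
  assumes p: "irreducible p" and c: "\<not> p dvd c"
  shows "\<exists>w. p dvd c * w - 1"
proof -
  define C where "C = (\<lambda>z. z \<noteq> 0 \<and> (\<exists>u v. z = u * c + v * p))"
  have "C p"
    unfolding C_def using p by (auto intro: exI[of _ 0] exI[of _ 1])
  define z where "z = arg_min degree C"
  have z: "C z" and zmin: "\<And>y. C y \<Longrightarrow> degree z \<le> degree y"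
    unfolding z_def using \<open>C p\<close> by (metis arg_min_natI, metis arg_min_nat_le)
  obtain u v where uv: "z = u * c + v * p" and "z \<noteq> 0"
    using z unfolding C_def by blast
  have dvd: "z dvd r * c + s * p" for r s
  proof (rule ccontr)
    assume *: "\<not> z dvd r * c + s * p"
    let ?m = "(r * c + s * p) mod z"
    have "?m = (r * c + s * p) - ((r * c + s * p) div z) * z"
      by (simp add: minus_div_mult_eq_mod)
    also have "\<dots> = (r - ((r * c + s * p) div z) * u) * c + (s - ((r * c + s * p) div z) * v) * p"
      by (subst (2) uv) (simp add: algebra_simps)
    finally have "C ?m"
      unfolding C_def using * by (auto simp: dvd_eq_mod_eq_0)
    then have "degree z \<le> degree ?m" "?m \<noteq> 0"
      using zmin unfolding C_def by auto
    then show False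
      using degree_mod_less[of z "r * c + s * p"] \<open>z \<noteq> 0\<close> by auto
  qed
  have "z dvd p" "z dvd c"
    using dvd[of 0 1] dvd[of 1 0] by simp_all
  then have "is_unit z"
    using c dvd_trans irreducibleD'[OF p, of z] by blast
  then obtain i where "1 = z * i"
    by blast
  then have "c * (u * i) - 1 = p * (- v * i)"
    by (simp add: uv algebra_simps)
  then show ?thesis
    by (metis dvd_triv_left)
qed

lemma invertible_mod_prime_power:
  fixes p c :: "'a::field poly"
  assumes "irreducible p" "\<not> p dvd c"
  shows "invertible_mod (p ^ k) c"
  using irreducible_bezout[OF assms] inverse_modulo_power unfolding invertible_mod_iff by blast

lemma degree_irreducible: "irreducible p \<Longrightarrow> 0 < degree (p::'a::field poly)"
  by (metis irreducible_def is_unit_iff_degree not_gr_zero)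

lemma monic_dvd_antisym:
  fixes g h :: "'r::idom poly"
  assumes "g dvd h" "h dvd g" "lead_coeff g = 1" "lead_coeff h = 1"
  shows "g = h"
proof -
  obtain c where c: "h = g * c"
    using assms(1) by blast
  have "h \<noteq> 0" "g \<noteq> 0" using assms(3,4) by auto
  then have "degree g = degree h"
    using dvd_imp_degree_le[OF assms(1)] dvd_imp_degree_le[OF assms(2)] by simp
  then have "degree c = 0"
    using c \<open>h \<noteq> 0\<close> by (auto simp: degree_mult_eq)
  then obtain a where "c = [:a:]"
    by (rule degree_eq_zeroE)
  then have "a = 1" and "h = smult a g"
    using c assms(3,4) lead_coeff_mult[of g c] by simp_all
  then show ?thesis
    by simp
qed

text \<open>
  Let \<open>j\<close> be the largest exponent such that \<open>p ^ j\<close> divides every element of \<open>S\<close>. For \<open>j < e\<close> some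
  \<open>s \<in> S\<close> is \<open>p ^ j\<close> times a unit modulo \<open>p ^ (e - j)\<close>, so that \<open>p ^ j\<close> is a combination of \<open>s\<close> and
  \<open>p ^ e\<close>; this makes it the greatest common divisor.
\<close>
lemma monic_gcd_prime_power:
  fixes p :: "'a::field poly"
  assumes p: "irreducible p" "lead_coeff p = 1" and S: "p ^ e \<in> S"
  obtains j where "j \<le> e" "monic_gcd S = p ^ j" "\<And>s. s \<in> S \<Longrightarrow> p ^ j dvd s"
    "j < e \<Longrightarrow> \<exists>s\<in>S. \<not> p ^ Suc j dvd s"
proof -
  define j where "j = (GREATEST j. j \<le> e \<and> (\<forall>s\<in>S. p ^ j dvd s))"
  have j: "j \<le> e \<and> (\<forall>s\<in>S. p ^ j dvd s)"
    unfolding j_def by (rule GreatestI_nat[of _ 0 e]) auto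
  have jmax: "i \<le> j" if "i \<le> e" "\<forall>s\<in>S. p ^ i dvd s" for i
    unfolding j_def by (rule Greatest_le_nat[of _ _ e]) (use that in auto)
  have ex: "\<exists>s\<in>S. \<not> p ^ Suc j dvd s" if "j < e"
    using jmax[of "Suc j"] that by auto
  have gcd: "h dvd p ^ j" if h: "\<forall>s\<in>S. h dvd s" for h
  proof (cases "j < e")
    case False
    then show ?thesis using j h S by auto
  next
    case True
    then obtain s where s: "s \<in> S" "\<not> p ^ Suc j dvd s"
      using ex by blast
    obtain s' where s': "s = p ^ j * s'"
      using j s(1) by blast
    have "\<not> p dvd s'"
      using s(2) unfolding s' by (auto simp: mult_dvd_mono mult.commute)
    then obtain w where "p ^ (e - j) dvd s' * w - 1"
      using invertible_mod_prime_power[OF p(1)] unfolding invertible_mod_iff by blast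
    then have "p ^ j * p ^ (e - j) dvd p ^ j * (s' * w - 1)"
      by (rule mult_dvd_mono[OF dvd_refl])
    then have "p ^ e dvd s * w - p ^ j"
      using True by (simp add: s' algebra_simps flip: power_add)
    then have "h dvd s * w - p ^ j"
      using h S by (blast intro: dvd_trans)
    moreover have "h dvd s * w"
      using h s(1) by simp
    ultimately show ?thesis
      using dvd_diff_right_iff by blast
  qed
  have "monic_gcd S = p ^ j"
    unfolding monic_gcd_def
  proof (rule the_equality)
    show "lead_coeff (p ^ j) = 1 \<and> (\<forall>s\<in>S. p ^ j dvd s) \<and> (\<forall>h. (\<forall>s\<in>S. h dvd s) \<longrightarrow> h dvd p ^ j)"
      using j gcd p by (simp add: lead_coeff_power)
  next
    fix g
    assume g: "lead_coeff g = 1 \<and> (\<forall>s\<in>S. g dvd s) \<and> (\<forall>h. (\<forall>s\<in>S. h dvd s) \<longrightarrow> h dvd g)"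
    then have "g dvd p ^ j" "p ^ j dvd g"
      using j gcd by auto
    moreover have "lead_coeff (p ^ j) = 1"
      using p by (simp add: lead_coeff_power)
    ultimately show "g = p ^ j"
      using g monic_dvd_antisym by blast
  qed
  with that j ex show ?thesis by blast
qed


section \<open>Reduction of coefficients and division by monic polynomials\<close>

lemma coeff_reduce: "coeff (reduce T f) i = coeff f i mod T"
  unfolding reduce_def by (simp add: coeff_map_poly)

lemma reduce_cong: "[:T:] dvd f - reduce T f"
  unfolding const_poly_dvd_iff coeff_diff coeff_reduce by (metis dvd_minus_mod)

lemma reduce_cong': "[:T:] dvd reduce T f - f"
  using reduce_cong by (rule dvd_diff_swap)

lemma degree_reduce_le: "degree (reduce T f) \<le> degree f"
  by (rule degree_le) (simp add: coeff_reduce coeff_eq_0)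

lemma reduce_eq_0_iff: "reduce T f = 0 \<longleftrightarrow> [:T:] dvd f"
  by (simp add: poly_eq_iff coeff_reduce const_poly_dvd_iff dvd_eq_mod_eq_0)

lemma one_mod_nonconstant: "0 < degree (T::'a::field poly) \<Longrightarrow> 1 mod T = 1"
  by (simp add: mod_poly_less)

lemma degree_reduce_eq:
  assumes "0 < degree T" "invertible_mod T (lead_coeff f)"
  shows "degree (reduce T f) = degree f"
proof (rule antisym[OF degree_reduce_le le_degree])
  show "coeff (reduce T f) (degree f) \<noteq> 0"
    using assms not_invertible_mod_0[of T] invertible_mod_mod[of T "lead_coeff f"]
    by (auto simp: coeff_reduce)
qed

lemma invertible_lead_coeff_reduce:
  assumes "0 < degree T" "invertible_mod T (lead_coeff f)"
  shows "invertible_mod T (lead_coeff (reduce T f))"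
  using assms by (simp add: degree_reduce_eq coeff_reduce invertible_mod_mod)

lemma reduce_monic:
  assumes "0 < degree T" "lead_coeff f = 1"
  shows "lead_coeff (reduce T f) = 1" "degree (reduce T f) = degree f"
  using degree_reduce_eq[of T f] assms
  by (auto simp: coeff_reduce one_mod_nonconstant invertible_mod_one)

lemma make_monic_mod:
  assumes "0 < degree T" "invertible_mod T (lead_coeff f)"
  shows "lead_coeff (make_monic_mod T f) = 1" "degree (make_monic_mod T f) = degree f"
proof -
  let ?g = "make_monic_mod T f"
  have "(inverse_mod T (lead_coeff f) * lead_coeff f) mod T = 1 mod T"
    using inverse_mod_dvd[OF assms(2)] by (simp add: mod_eq_dvd_iff mult.commute)
  then have 1: "coeff ?g (degree f) = 1"
    unfolding make_monic_mod_def
    by (simp add: coeff_reduce one_mod_nonconstant[OF assms(1)])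
  have "degree ?g \<le> degree f"
    unfolding make_monic_mod_def by (meson degree_reduce_le degree_smult_le order_trans)
  moreover have "degree f \<le> degree ?g"
    using 1 by (intro le_degree) simp
  ultimately show "degree ?g = degree f" by simp
  with 1 show "lead_coeff ?g = 1" by simp
qed

lemma monic_pseudo_divmod:
  fixes f h :: "'r::idom poly"
  assumes "lead_coeff h = 1" "pseudo_divmod f h = (q, r)"
  shows "f = h * q + r" "r = 0 \<or> degree r < degree h"
proof -
  have "h \<noteq> 0" using assms(1) by auto
  then show "f = h * q + r" "r = 0 \<or> degree r < degree h"
    using pseudo_divmod[OF _ assms(2)] assms(1) by auto
qed

text \<open>Uniqueness of division with remainder by a monic polynomial.\<close>
lemma monic_mult_small_degree:
  fixes h q r :: "'r::idom poly"
  assumes "lead_coeff h = 1" "h * q = r" "r = 0 \<or> degree r < degree h"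
  shows "q = 0"
proof (rule ccontr)
  assume "q \<noteq> 0"
  moreover have "h \<noteq> 0" using assms(1) by auto
  ultimately have "r \<noteq> 0" "degree h \<le> degree r"
    using assms(2) by (auto simp: degree_mult_eq)
  with assms(3) show False by simp
qed

lemma monic_division_dvd:
  fixes h q r :: "'r::idom poly"
  assumes h: "lead_coeff h = 1" and r: "r = 0 \<or> degree r < degree h" and "[:m:] dvd h * q + r"
  shows "[:m:] dvd q" "[:m:] dvd r"
proof -
  obtain X where X: "h * q + r = [:m:] * X"
    using assms(3) by blast
  obtain q' r' where qr: "pseudo_divmod X h = (q', r')"
    by fastforce
  note d = monic_pseudo_divmod[OF h qr]
  have "h * (q - [:m:] * q') = [:m:] * r' - r"
    using X d(1) by (simp add: algebra_simps)
  moreover have "[:m:] * r' - r = 0 \<or> degree ([:m:] * r' - r) < degree h"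
  proof (cases "degree h = 0")
    case False
    have "degree ([:m:] * r') < degree h"
      using d(2) False degree_smult_le[of m r'] by auto
    moreover have "degree r < degree h"
      using r False by auto
    ultimately show ?thesis
      by (simp add: degree_diff_less)
  qed (use r d(2) in auto)
  ultimately have "q - [:m:] * q' = 0"
    by (rule monic_mult_small_degree[OF h])
  then have q: "q = [:m:] * q'" by (simp only: right_minus_eq)
  then show "[:m:] dvd q" by (simp only: dvd_triv_left)
  with assms(3) show "[:m:] dvd r"
    by (metis dvd_add_right_iff dvd_mult)
qed


section \<open>Hensel lifting\<close>

text \<open>
  With \<open>e \<equiv> f - g h\<close> and \<open>s e \<equiv> q h + r\<close>, the product of the corrected factors differs from \<open>f\<close> by
  \<open>e (s g + t h - 1) + r (t e + q g)\<close> modulo \<open>M\<^sup>2\<close>, and each of these products has two factors in \<open>M\<close>.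
\<close>
lemma hensel_factors:
  fixes M :: "'r::comm_ring_1"
  assumes "M dvd e" "M dvd q" "M dvd r" "M dvd s * g + t * h - 1"
    and "M\<^sup>2 dvd f - g * h - e" "M\<^sup>2 dvd s * e - (h * q + r)"
    and "M\<^sup>2 dvd g' - (g + t * e + q * g)" "M\<^sup>2 dvd h' - (h + r)"
  shows "M\<^sup>2 dvd f - g' * h'"
proof -
  let ?g = "g + t * e + q * g"
  have "M * M dvd e * (s * g + t * h - 1)" "M * M dvd r * (t * e + q * g)"
    using assms(1-4) by (intro mult_dvd_mono dvd_add; simp)+
  then have "M\<^sup>2 dvd e * (s * g + t * h - 1)" "M\<^sup>2 dvd r * (t * e + q * g)"
    by (simp_all add: power2_eq_square)
  then have "M\<^sup>2 dvd (f - g * h - e) - e * (s * g + t * h - 1) + g * (s * e - (h * q + r))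
      - r * (t * e + q * g) - (g' - ?g) * h' - ?g * (h' - (h + r))"
    by (intro dvd_diff[OF dvd_diff[OF dvd_diff[OF dvd_add[OF dvd_diff]]]]
        dvd_mult[OF assms(6)] dvd_mult2[OF assms(7)] dvd_mult[OF assms(8)] assms(5))
  also have "\<dots> = f - g' * h'"
    by (simp add: algebra_simps)
  finally show ?thesis .
qed

text \<open>
  If \<open>b\<close> is the defect of the Bezout identity for \<open>s, t\<close>, then the defect for the corrected cofactors
  is \<open>- b\<^sup>2\<close> modulo \<open>M\<^sup>2\<close>.
\<close>
lemma hensel_cofactors:
  fixes M :: "'r::comm_ring_1"
  assumes "M dvd b"
    and "M\<^sup>2 dvd s * g + t * h - 1 - b" "M\<^sup>2 dvd s * b - (h * c + d)"
    and "M\<^sup>2 dvd s' - (s - d)" "M\<^sup>2 dvd t' - (t - t * b - c * g)"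
  shows "M\<^sup>2 dvd s' * g + t' * h - 1"
proof -
  have "M\<^sup>2 dvd b\<^sup>2"
    using assms(1) by (rule dvd_power_same)
  then have "M\<^sup>2 dvd (s' - (s - d)) * g + (t' - (t - t * b - c * g)) * h
     + (s * g + t * h - 1 - b) * (1 - b) + g * (s * b - (h * c + d)) - b\<^sup>2"
    using assms(2-5) by (intro dvd_diff dvd_add) (auto intro: dvd_mult dvd_mult2)
  also have "\<dots> = s' * g + t' * h - 1"
    by (simp add: algebra_simps power2_eq_square)
  finally show ?thesis .
qed

lemma hensel_step_correct:
  fixes f g h s t :: "'a::field poly poly"
  assumes m: "0 < degree m" and h: "lead_coeff h = 1"
    and fgh: "[:m:] dvd f - g * h" and st: "[:m:] dvd s * g + t * h - 1"
    and step: "hensel_step m f (g, h, s, t) = (g', h', s', t')"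
  shows "lead_coeff h' = 1" "degree h' = degree h"
    "[:m ^ 2:] dvd f - g' * h'" "[:m ^ 2:] dvd s' * g' + t' * h' - 1" "[:m:] dvd g' - g"
proof -
  define R where "R = reduce (m ^ 2)"
  define e where "e = R (f - g * h)"
  obtain q r where qr: "pseudo_divmod (R (s * e)) h = (q, r)" by fastforce
  define G where "G = R (g + t * e + q * g)"
  define H where "H = R (h + r)"
  define b where "b = R (s * G + t * H - 1)"
  obtain c d where cd: "pseudo_divmod (R (s * b)) H = (c, d)" by fastforce
  have "hensel_step m f (g, h, s, t) = (G, H, R (s - d), R (t - t * b - c * G))"
    unfolding hensel_step_def Let_def prod.case R_def[symmetric] e_def[symmetric] qr
      G_def[symmetric] H_def[symmetric] b_def[symmetric] cd
    by (rule refl)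
  then have GH: "G = g'" "H = h'" and s': "s' = R (s - d)" and t': "t' = R (t - t * b - c * g')"
    using step by simp_all
  note g' = G_def[unfolded GH] and h' = H_def[unfolded GH]
    and b_def = b_def[unfolded GH] and cd = cd[unfolded GH]
  have sq: "[:m:]\<^sup>2 = [:m ^ 2:]"
    by (simp add: power2_eq_square)
  have R: "[:m:]\<^sup>2 dvd f - R f" "[:m:]\<^sup>2 dvd R f - f" for f
    unfolding sq R_def by (rule reduce_cong reduce_cong')+
  have m_dvd: "[:m:] dvd x" if "[:m:]\<^sup>2 dvd x" for x
    by (rule dvd_trans[OF _ that]) (simp add: power2_eq_square)
  have dvdR: "[:m:] dvd R f \<longleftrightarrow> [:m:] dvd f" for f
    using dvd_add_right_iff[OF m_dvd[OF R(1)[of f]], of "R f"] by simp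
  have e: "[:m:] dvd e"
    unfolding e_def dvdR by (rule fgh)
  note qr' = monic_pseudo_divmod[OF h qr]
  have "[:m:] dvd R (s * e)"
    using e by (simp add: dvdR del: mult_pCons_left mult_pCons_right)
  then have q: "[:m:] dvd q" and r: "[:m:] dvd r"
    using monic_division_dvd[OF h qr'(2), of m q] unfolding qr'(1) by auto
  have hr: "lead_coeff (h + r) = 1" "degree (h + r) = degree h"
    using qr'(2) h by (auto simp: degree_add_eq_left coeff_eq_0)
  have m2: "0 < degree (m ^ 2)"
    using m by (subst degree_power_eq) auto
  show lh': "lead_coeff h' = 1" and "degree h' = degree h"
    unfolding h' R_def using reduce_monic[OF m2 hr(1)] hr(2) by simp_all
  have "[:m:]\<^sup>2 dvd f - g' * h'"
  proof (rule hensel_factors[OF e q r st])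
    show "[:m:]\<^sup>2 dvd f - g * h - e"
      unfolding e_def by (rule R)
    show "[:m:]\<^sup>2 dvd s * e - (h * q + r)"
      unfolding qr'(1)[symmetric] by (rule R)
    show "[:m:]\<^sup>2 dvd g' - (g + t * e + q * g)"
      unfolding g' by (rule R)
    show "[:m:]\<^sup>2 dvd h' - (h + r)"
      unfolding h' by (rule R)
  qed
  then show "[:m ^ 2:] dvd f - g' * h'"
    by (simp only: sq)
  have "[:m:] dvd (g' - (g + t * e + q * g)) + (t * e + q * g)"
    unfolding g' using e q by (intro dvd_add m_dvd[OF R(2)] dvd_mult dvd_mult2)
  then show gg: "[:m:] dvd g' - g"
    by (simp add: algebra_simps)
  have "[:m:] dvd (h' - (h + r)) + r"
    unfolding h' using r by (intro dvd_add m_dvd[OF R(2)])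
  then have hh: "[:m:] dvd h' - h"
    by (simp add: algebra_simps)
  have "[:m:] dvd s * (g' - g) + t * (h' - h) + (s * g + t * h - 1)"
    using gg hh st by (intro dvd_add dvd_mult)
  then have b: "[:m:] dvd b"
    unfolding b_def dvdR by (simp add: algebra_simps)
  note cd' = monic_pseudo_divmod[OF lh' cd]
  have "[:m:]\<^sup>2 dvd s' * g' + t' * h' - 1"
  proof (rule hensel_cofactors[OF b])
    show "[:m:]\<^sup>2 dvd s * g' + t * h' - 1 - b"
      unfolding b_def by (rule R)
    show "[:m:]\<^sup>2 dvd s * b - (h' * c + d)"
      unfolding cd'(1)[symmetric] by (rule R)
    show "[:m:]\<^sup>2 dvd s' - (s - d)"
      unfolding s' by (rule R)
    show "[:m:]\<^sup>2 dvd t' - (t - t * b - c * g')"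
      unfolding t' by (rule R)
  qed
  then show "[:m ^ 2:] dvd s' * g' + t' * h' - 1"
    by (simp only: sq)
qed

lemma hensel_lift_correct:
  fixes f g h s t :: "'a::field poly poly"
  assumes N: "0 < degree N" and h: "lead_coeff h = 1"
    and "[:N:] dvd f - g * h" "[:N:] dvd s * g + t * h - 1"
  shows "\<exists>g' h' s' t'. hensel_lift N f (g, h, s, t) j = (g', h', s', t') \<and>
    lead_coeff h' = 1 \<and> degree h' = degree h \<and> [:N ^ (2 ^ j):] dvd f - g' * h' \<and>
    [:N ^ (2 ^ j):] dvd s' * g' + t' * h' - 1 \<and> [:N:] dvd g' - g"
proof (induction j)
  case 0
  show ?case using assms by simp
next
  case (Suc j)
  then obtain g1 h1 s1 t1 where IH: "hensel_lift N f (g, h, s, t) j = (g1, h1, s1, t1)"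
    "lead_coeff h1 = 1" "degree h1 = degree h" "[:N ^ (2 ^ j):] dvd f - g1 * h1"
    "[:N ^ (2 ^ j):] dvd s1 * g1 + t1 * h1 - 1" "[:N:] dvd g1 - g"
    by blast
  obtain g' h' s' t' where step: "hensel_step (N ^ (2 ^ j)) f (g1, h1, s1, t1) = (g', h', s', t')"
    using prod_cases4 by blast
  have "0 < degree (N ^ (2 ^ j))"
    using N by (subst degree_power_eq) auto
  note correct = hensel_step_correct[OF this IH(2,4,5) step]
  have "[:N:] dvd [:N ^ (2 ^ j):]"
    unfolding const_poly_dvd_const_poly_iff by (rule dvd_power) simp
  then have "[:N:] dvd g' - g1"
    using correct(5) dvd_trans by blast
  then have "[:N:] dvd (g' - g1) + (g1 - g)"
    using IH(6) by (rule dvd_add)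
  then have "[:N:] dvd g' - g"
    by simp
  moreover have "N ^ (2 ^ Suc j) = (N ^ (2 ^ j))\<^sup>2"
    by (simp add: mult.commute flip: power_mult)
  ultimately show ?case
    unfolding hensel_lift.simps IH(1) using step correct(1-4) IH(3) by metis
qed


section \<open>Monic associates modulo a prime power\<close>

text \<open>
  In the notation of \<open>MonicForm\<close>: above the degree \<open>d\<close> all coefficients of \<open>f'\<close> are multiples of \<open>p\<close>, so \<open>N\<close> is a nontrivial power
  of \<open>p\<close> and repeated squaring of \<open>N\<close> reaches a multiple of \<open>T'\<close>. The lifted cofactor is congruent modulo \<open>p\<close> to
  the unit \<open>c\<^sub>d\<close>, hence a unit modulo \<open>T'\<close>: modulo \<open>T'\<close>, \<open>f'\<close> and its monic factor divide
  each other.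
\<close>
lemma monic_form_correct:
  fixes f :: "'a::field poly poly"
  assumes p: "irreducible p" "lead_coeff p = 1" and f: "\<not> [:p ^ e:] dvd f"
  obtains j b g w where "monic_form f (p ^ e) = (b, p ^ j)" "j < e" "[:p ^ j:] dvd f"
    "lead_coeff b = 1" "degree b \<le> degree f"
    "j = 0 \<Longrightarrow> \<not> invertible_mod (p ^ e) (lead_coeff f) \<Longrightarrow> degree b < degree f"
    "[:p ^ e:] dvd f - g * ([:p ^ j:] * b)" "[:p ^ e:] dvd [:p ^ j:] * b - w * f"
proof -
  have "p ^ e \<in> insert (p ^ e) (range (coeff f))" by simp
  from monic_gcd_prime_power[OF p this] obtain j where "j \<le> e"
    and U: "monic_gcd (insert (p ^ e) (range (coeff f))) = p ^ j"
    and dvd: "\<And>s. s \<in> insert (p ^ e) (range (coeff f)) \<Longrightarrow> p ^ j dvd s"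
    and ex: "j < e \<Longrightarrow> \<exists>s\<in>insert (p ^ e) (range (coeff f)). \<not> p ^ Suc j dvd s"
    by metis
  have "j \<noteq> e"
    using dvd f unfolding const_poly_dvd_iff by auto
  with \<open>j \<le> e\<close> have j: "j < e" by simp
  have p0: "p \<noteq> 0" using p by auto
  define n where "n = e - j"
  have n: "0 < n" using j by (simp add: n_def)
  have pe: "p ^ e = p ^ j * p ^ n"
    using j by (simp add: n_def flip: power_add)
  have T': "p ^ e div p ^ j = p ^ n"
    using p0 by (simp add: pe)
  have degT': "0 < degree (p ^ n)"
    using p0 n degree_irreducible[OF p(1)] by (simp add: degree_power_eq)
  define f' where "f' = map_poly (\<lambda>c. c div p ^ j) f"
  have cf: "coeff f i = p ^ j * coeff f' i" for i
    using dvd[of "coeff f i"] by (simp add: f'_def coeff_map_poly)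
  then have f_eq: "f = [:p ^ j:] * f'"
    by (simp add: poly_eq_iff)
  define P where "P = (\<lambda>d. invertible_mod (p ^ n) (coeff f' d))"
  obtain s where "s \<in> insert (p ^ e) (range (coeff f))" "\<not> p ^ Suc j dvd s"
    using ex[OF j] by blast
  moreover have "p ^ Suc j dvd p ^ e"
    using j by (intro le_imp_power_dvd) simp
  ultimately obtain i where "\<not> p ^ Suc j dvd coeff f i"
    by auto
  then have "\<not> p dvd coeff f' i"
    unfolding cf by (auto simp: mult_dvd_mono mult.commute)
  then have "P i"
    unfolding P_def by (rule invertible_mod_prime_power[OF p(1)])
  have Pbound: "P y \<Longrightarrow> y \<le> degree f'" for y
    unfolding P_def using not_invertible_mod_0[OF degT'] by (metis le_degree)
  define d where "d = (GREATEST d. P d)"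
  have "P d"
    unfolding d_def using \<open>P i\<close> Pbound by (rule GreatestI_nat) auto
  have above: "p dvd coeff f' k" if "k > d" for k
  proof (rule ccontr)
    assume "\<not> p dvd coeff f' k"
    then have "P k"
      unfolding P_def by (rule invertible_mod_prime_power[OF p(1)])
    then have "k \<le> d"
      unfolding d_def using Pbound by (rule Greatest_le_nat) auto
    with that show False by simp
  qed
  define c where "c = coeff f' d"
  have c: "invertible_mod (p ^ n) c"
    using \<open>P d\<close> by (simp add: P_def c_def)
  define \<alpha> where "\<alpha> = inverse_mod (p ^ n) c"
  have c\<alpha>: "p ^ n dvd c * \<alpha> - 1"
    unfolding \<alpha>_def by (rule inverse_mod_dvd[OF c])
  define S where "S = insert (p ^ n) {coeff f' j | j. j > d}"
  have "p ^ n \<in> S" by (simp add: S_def)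
  from monic_gcd_prime_power[OF p this] obtain m where m: "m \<le> n"
    and N: "monic_gcd S = p ^ m" "\<And>s. s \<in> S \<Longrightarrow> p ^ m dvd s"
    and exN: "m < n \<Longrightarrow> \<exists>s\<in>S. \<not> p ^ Suc m dvd s"
    by metis
  have "m \<noteq> 0"
  proof
    assume "m = 0"
    then obtain s where "s \<in> S" "\<not> p dvd s"
      using exN n by auto
    moreover have "p dvd p ^ n"
      using n by (rule dvd_power[OF disjI1])
    ultimately show False
      using above by (auto simp: S_def)
  qed
  then have degN: "0 < degree (p ^ m)"
    using p0 degree_irreducible[OF p(1)] by (simp add: degree_power_eq)
  have NT': "p ^ m dvd p ^ n"
    using m by (rule le_imp_power_dvd)
  define b0 where "b0 = reduce (p ^ m) (smult \<alpha> f')"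
  have b0_d: "coeff b0 d = 1"
  proof -
    have "p ^ m dvd \<alpha> * c - 1"
      using c\<alpha> NT' by (metis dvd_trans mult.commute)
    then have "(\<alpha> * c) mod p ^ m = 1 mod p ^ m"
      by (simp add: mod_eq_dvd_iff)
    then show ?thesis
      by (simp add: b0_def coeff_reduce one_mod_nonconstant[OF degN] flip: c_def)
  qed
  have "coeff b0 k = 0" if "k > d" for k
    using N(2)[of "coeff f' k"] that by (auto simp: b0_def coeff_reduce S_def simp flip: dvd_eq_mod_eq_0 intro: dvd_mult)
  then have deg_b0: "degree b0 = d"
    using b0_d by (intro antisym degree_le le_degree) auto
  then have lb0: "lead_coeff b0 = 1"
    using b0_d by simp
  have start: "[:p ^ m:] dvd [:\<alpha>:] * [:c:] + 0 * b0 - 1"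
  proof -
    have "[:\<alpha>:] * [:c:] + 0 * b0 - 1 = [:c * \<alpha> - 1:]"
      by (simp add: one_pCons mult.commute)
    then show ?thesis
      using c\<alpha> NT' dvd_trans by (simp only: const_poly_dvd_const_poly_iff) blast
  qed
  have factor: "[:p ^ m:] dvd f' - [:c:] * b0"
  proof -
    have red: "[:p ^ m:] dvd [:\<alpha>:] * f' - b0"
      using reduce_cong[of "p ^ m" "smult \<alpha> f'"] by (simp add: b0_def)
    have "[:p ^ m:] dvd [:c:] * ([:\<alpha>:] * f' - b0) - f' * ([:\<alpha>:] * [:c:] + 0 * b0 - 1)"
      by (rule dvd_diff[OF dvd_mult[OF red] dvd_mult[OF start]])
    also have "\<dots> = f' - [:c:] * b0"
      by (simp add: algebra_simps)
    finally show ?thesis .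
  qed
  define \<epsilon> where "\<epsilon> = (LEAST \<epsilon>. p ^ n dvd (p ^ m) ^ (2 ^ \<epsilon>))"
  \<comment> \<open>\<open>n\<close> squarings suffice, so a least \<open>\<epsilon>\<close> exists.\<close>
  have "n \<le> m * 2 ^ n"
    using \<open>m \<noteq> 0\<close> less_exp[of n] by (cases m) (auto intro: trans_le_add1 less_imp_le)
  then have "p ^ n dvd (p ^ m) ^ (2 ^ n)"
    unfolding power_mult[symmetric] by (rule le_imp_power_dvd)
  then have \<epsilon>: "p ^ n dvd (p ^ m) ^ (2 ^ \<epsilon>)"
    unfolding \<epsilon>_def by (rule LeastI)
  obtain g h s t where lift: "hensel_lift (p ^ m) f' ([:c:], b0, [:\<alpha>:], 0) \<epsilon> = (g, h, s, t)"
    and h: "lead_coeff h = 1" "degree h = degree b0" and fgh: "[:(p ^ m) ^ (2 ^ \<epsilon>):] dvd f' - g * h"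
    and g: "[:p ^ m:] dvd g - [:c:]"
    using hensel_lift_correct[OF degN lb0 factor start, of \<epsilon>] by blast
  define b where "b = reduce (p ^ n) h"
  have b: "lead_coeff b = 1" "degree b = d"
    unfolding b_def using reduce_monic[OF degT' h(1)] h(2) deg_b0 by simp_all
  have mf: "monic_form f (p ^ e) = (b, p ^ j)"
    unfolding monic_form_def Let_def U T' f'_def[symmetric] P_def[symmetric] d_def[symmetric]
      c_def[symmetric] \<alpha>_def[symmetric] S_def[symmetric] N(1) b0_def[symmetric] \<epsilon>_def[symmetric]
      lift prod.case b_def[symmetric]
    by (rule refl)
  have "[:p ^ n:] dvd f' - g * h"
    using \<epsilon> fgh by (meson const_poly_dvd_const_poly_iff dvd_trans)
  then have "[:p ^ n:] dvd (f' - g * h) + g * (h - b)"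
    unfolding b_def by (intro dvd_add dvd_mult reduce_cong)
  then have f'gb: "[:p ^ n:] dvd f' - g * b"
    by (simp add: algebra_simps)
  \<comment> \<open>The inverse \<open>\<alpha>\<close> of \<open>c\<close> inverts \<open>g\<close> modulo \<open>p\<close>; this inverse lifts to the modulus \<open>p ^ n\<close>.\<close>
  obtain w where w: "[:p ^ n:] dvd g * w - 1"
  proof -
    have pN: "[:p:] dvd [:p ^ m:]" "[:p:] dvd [:p ^ n:]"
      using \<open>m \<noteq> 0\<close> n by (auto intro!: dvd_power)
    have "[:p:] dvd [:c * \<alpha> - 1:]"
      using c\<alpha> pN(2) by (meson const_poly_dvd_const_poly_iff dvd_trans)
    then have "[:p:] dvd (g - [:c:]) * [:\<alpha>:] + [:c * \<alpha> - 1:]"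
      using g pN(1) by (intro dvd_add dvd_mult2) (blast intro: dvd_trans)+
    also have "\<dots> = g * [:\<alpha>:] - 1"
      by (simp add: algebra_simps one_pCons)
    finally have "\<exists>w. [:p:] ^ n dvd g * w - 1"
      by (rule inverse_modulo_power)
    then show ?thesis
      using that by (auto simp: poly_const_pow)
  qed
  have pe': "[:p ^ e:] = [:p ^ j:] * [:p ^ n:]"
    by (simp add: pe)
  show thesis
  proof (rule that[OF mf j])
    show "[:p ^ j:] dvd f"
      unfolding f_eq by (rule dvd_triv_left)
    show "lead_coeff b = 1" by (rule b(1))
    have deg: "degree f' = degree f"
      using p0 by (simp add: f_eq)
    then show "degree b \<le> degree f"
      using Pbound[OF \<open>P d\<close>] b(2) by simp
    show "degree b < degree f" if "j = 0" "\<not> invertible_mod (p ^ e) (lead_coeff f)"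
    proof -
      have "f' = f" "n = e"
        using that(1) f_eq by (simp_all add: n_def)
      then have "d \<noteq> degree f"
        using that(2) \<open>P d\<close> unfolding P_def by auto
      then show ?thesis
        using Pbound[OF \<open>P d\<close>] b(2) deg by simp
    qed
    have "f - g * ([:p ^ j:] * b) = [:p ^ j:] * (f' - g * b)"
      unfolding f_eq by (simp only: algebra_simps)
    then show "[:p ^ e:] dvd f - g * ([:p ^ j:] * b)"
      unfolding pe' using f'gb by (simp only: mult_dvd_mono dvd_refl)
    have "[:p ^ n:] dvd (g * w - 1) * (- b) + (- w) * (f' - g * b)"
      by (rule dvd_add[OF dvd_mult2[OF w] dvd_mult[OF f'gb]])
    also have "\<dots> = b - w * f'"
      by (simp add: algebra_simps)
    finally have "[:p ^ n:] dvd b - w * f'" .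
    moreover have "[:p ^ j:] * b - w * f = [:p ^ j:] * (b - w * f')"
      unfolding f_eq by (simp only: algebra_simps)
    ultimately show "[:p ^ e:] dvd [:p ^ j:] * b - w * f"
      unfolding pe' by (simp only: mult_dvd_mono dvd_refl)
  qed
qed


section \<open>Finitely generated ideals\<close>

lemma mem_ideal3: "x \<in> ideal {a, b, c} \<longleftrightarrow> (\<exists>q r s. x = q * a + r * b + s * c)"
  unfolding ideal_def module.span_insert[OF module_mult] module.span_empty[OF module_mult]
  by (auto simp: algebra_simps)

lemma ideal_generator: "x \<in> S \<Longrightarrow> x \<in> ideal S"
  unfolding ideal_def by (rule module.span_base[OF module_mult])

lemma ideal_subset: "S \<subseteq> ideal X \<Longrightarrow> ideal S \<subseteq> ideal X"
  unfolding ideal_def by (metis module.span_mono[OF module_mult] module.span_span[OF module_mult])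

lemma ideal_mult: "x \<in> ideal S \<Longrightarrow> q * x \<in> ideal S"
  unfolding ideal_def by (rule module.span_scale[OF module_mult])

lemma mem_ideal3_cong:
  assumes "t dvd x - (q * a + r * b)"
  shows "x \<in> ideal {a, b, t}"
proof -
  obtain k where "x - (q * a + r * b) = t * k"
    using assms by blast
  then have "x = q * a + r * b + k * t"
    by (simp add: algebra_simps)
  then show ?thesis
    unfolding mem_ideal3 by blast
qed

lemma ideal3_eqI:
  assumes "a' \<in> ideal {a, b, t}" "b' \<in> ideal {a, b, t}" "a \<in> ideal {a', b', t}" "b \<in> ideal {a', b', t}"
  shows "ideal {a, b, t} = ideal {a', b', t}"
  using assms ideal_generator[of t] by (intro antisym ideal_subset) auto

lemma ideal3_associated:
  assumes "t dvd b - g * b'" "t dvd b' - w * b"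
  shows "ideal {a, b, t} = ideal {a, b', t}"
  using mem_ideal3_cong[of t b 0 a g b'] mem_ideal3_cong[of t b' 0 a w b] assms
  by (intro ideal3_eqI) (auto intro: ideal_generator)

lemma ideal3_remainder:
  assumes "t dvd c - (\<alpha> * a + \<beta> * b)" "t dvd \<alpha> * \<alpha>' - 1"
  shows "ideal {a, b, t} = ideal {b, c, t}"
proof (rule ideal3_eqI)
  have "t dvd (\<alpha> * \<alpha>' - 1) * (- a) + (- \<alpha>') * (c - (\<alpha> * a + \<beta> * b))"
    by (rule dvd_add[OF dvd_mult2[OF assms(2)] dvd_mult[OF assms(1)]])
  also have "\<dots> = a - ((- \<alpha>' * \<beta>) * b + \<alpha>' * c)"
    by (simp add: algebra_simps)
  finally show "a \<in> ideal {b, c, t}"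
    by (rule mem_ideal3_cong)
  show "c \<in> ideal {a, b, t}"
    using assms(1) by (rule mem_ideal3_cong)
qed (auto intro: ideal_generator)

lemma ideal3_reduce: "ideal {reduce T a, reduce T b, [:T:]} = ideal {a, b, [:T:]}"
proof (rule ideal3_eqI)
  show "a \<in> ideal {reduce T a, reduce T b, [:T:]}"
    by (rule mem_ideal3_cong[of _ _ 1 _ 0]) (simp add: reduce_cong)
  show "b \<in> ideal {reduce T a, reduce T b, [:T:]}"
    by (rule mem_ideal3_cong[of _ _ 0 _ 1]) (simp add: reduce_cong)
  show "reduce T a \<in> ideal {a, b, [:T:]}"
    by (rule mem_ideal3_cong[of _ _ 1 _ 0]) (simp add: reduce_cong')
  show "reduce T b \<in> ideal {a, b, [:T:]}"
    by (rule mem_ideal3_cong[of _ _ 0 _ 1]) (simp add: reduce_cong')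
qed

lemma ideal3_make_monic:
  assumes "invertible_mod T (lead_coeff a)"
  shows "ideal {a, b, [:T:]} = ideal {make_monic_mod T a, b, [:T:]}"
proof -
  let ?l = "lead_coeff a" and ?i = "inverse_mod T (lead_coeff a)"
  have 1: "[:T:] dvd make_monic_mod T a - [:?i:] * a"
    using reduce_cong'[of T "smult ?i a"] by (simp add: make_monic_mod_def)
  have "[:T:] dvd [:?l * ?i - 1:]"
    using inverse_mod_dvd[OF assms] by simp
  then have "[:T:] dvd [:?l * ?i - 1:] * (- a) + [:- ?l:] * (make_monic_mod T a - [:?i:] * a)"
    using 1 by (rule dvd_add[OF dvd_mult2 dvd_mult])
  also have "\<dots> = a - [:?l:] * make_monic_mod T a"
    by (simp add: algebra_simps smult_diff_left)
  finally have "ideal {b, a, [:T:]} = ideal {b, make_monic_mod T a, [:T:]}"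
    using 1 by (rule ideal3_associated)
  then show ?thesis
    by (simp add: insert_commute)
qed


section \<open>Polynomial remainder sequences modulo \<open>T\<close>\<close>

lemma reduce_pseudo_mod:
  fixes A B :: "'a::field poly poly"
  assumes T: "0 < degree T" and B: "invertible_mod T (lead_coeff B)" and \<mu>: "invertible_mod T \<mu>"
    and C: "C = reduce T (smult \<mu> (pseudo_mod A B))"
  shows "ideal {A, B, [:T:]} = ideal {B, C, [:T:]}" "C = 0 \<or> degree C < degree B"
proof -
  have "B \<noteq> 0"
    using B not_invertible_mod_0[OF T] by auto
  obtain q r where qr: "pseudo_divmod A B = (q, r)" by fastforce
  define l where "l = lead_coeff B ^ (Suc (degree A) - degree B)"
  have div: "smult l A = B * q + r" "r = 0 \<or> degree r < degree B"
    using pseudo_divmod[OF \<open>B \<noteq> 0\<close> qr] by (simp_all add: l_def)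
  have C': "C = reduce T (smult \<mu> r)"
    by (simp add: C pseudo_mod_def qr)
  then show "C = 0 \<or> degree C < degree B"
    using div(2) degree_reduce_le[of T "smult \<mu> r"] degree_smult_le[of \<mu> r]
    by (auto simp: reduce_eq_0_iff)
  obtain w where "T dvd (\<mu> * l) * w - 1"
    using B \<mu> invertible_mod_mult invertible_mod_power unfolding l_def invertible_mod_iff[symmetric]
    by (metis invertible_mod_iff)
  moreover have "[:\<mu> * l:] * [:w:] - 1 = [:(\<mu> * l) * w - 1:]"
    by (simp add: one_pCons mult.commute)
  ultimately have w: "[:T:] dvd [:\<mu> * l:] * [:w:] - 1"
    by (simp only: const_poly_dvd_const_poly_iff)
  have "r = smult l A - B * q"
    by (simp add: div(1))
  then have "smult \<mu> r = [:\<mu> * l:] * A + (- [:\<mu>:] * q) * B"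
    by (simp add: smult_diff_right mult.commute)
  then have "[:T:] dvd C - ([:\<mu> * l:] * A + (- [:\<mu>:] * q) * B)"
    unfolding C' by (metis reduce_cong')
  then show "ideal {A, B, [:T:]} = ideal {B, C, [:T:]}"
    using w by (rule ideal3_remainder)
qed

lemma subres_1: "subres T f1 f2 (Suc 0) = f1"
  by (subst subres.simps) simp

lemma subres_2: "subres T f1 f2 2 = f2"
  by (subst subres.simps) simp

lemma invertible_subres_c:
  assumes "\<And>j. 1 \<le> j \<Longrightarrow> j < i \<Longrightarrow> invertible_mod T (lead_coeff (subres T f1 f2 j))"
  shows "invertible_mod T (subres_c T f1 f2 i)"
  using assms
proof (induction i)
  case 0
  show ?case
    by (subst subres_c.simps) (simp add: invertible_mod_one invertible_mod_uminus)
next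
  case (Suc i)
  have c: "invertible_mod T (subres_c T f1 f2 i)"
    by (rule Suc.IH) (use Suc.prems in auto)
  show ?case
  proof (cases "Suc i \<le> 3")
    case True
    then show ?thesis
      by (subst subres_c.simps) (simp add: invertible_mod_one invertible_mod_uminus)
  next
    case False
    then have "invertible_mod T (lead_coeff (subres T f1 f2 (Suc i - 2)))"
      by (intro Suc.prems) auto
    with c False show ?thesis
      by (subst subres_c.simps)
        (auto simp: Let_def invertible_mod_mod
          intro!: invertible_mod_mult invertible_mod_power invertible_inverse_mod)
  qed
qed

text \<open>
  The elements \<open>c\<^sub>i\<close> and the divisors prescribed for the subresultant sequence are units modulo \<open>T\<close> as long as the leading
  coefficients are, so each step is a pseudo-division up to a unit.
\<close>
lemma subres_Suc:
  assumes inv: "\<And>j. 1 \<le> j \<Longrightarrow> j \<le> n \<Longrightarrow> invertible_mod T (lead_coeff (subres T f1 f2 j))" and n: "2 \<le> n"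
  obtains \<mu> where "invertible_mod T \<mu>"
    "subres T f1 f2 (Suc n) = reduce T (smult \<mu> (pseudo_mod (subres T f1 f2 (n - 1)) (subres T f1 f2 n)))"
proof (cases "n = 2")
  case True
  have "invertible_mod T ((-1) ^ (degree f1 - degree f2 + 1))"
    by (intro invertible_mod_power invertible_mod_uminus invertible_mod_one)
  moreover have "subres T f1 f2 (Suc n) = reduce T (smult ((-1) ^ (degree f1 - degree f2 + 1)) (pseudo_mod f1 f2))"
    using True by (subst subres.simps) (simp add: minus_one_power_iff)
  ultimately show thesis
    using that True by (simp add: subres_1 subres_2)
next
  case False
  define \<mu> where "\<mu> = inverse_mod T (- lead_coeff (subres T f1 f2 (n - 1)) *
    (- subres_c T f1 f2 (Suc n)) ^ (degree (subres T f1 f2 (n - 1)) - degree (subres T f1 f2 n)))"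
  have "invertible_mod T (subres_c T f1 f2 (Suc n))"
    by (rule invertible_subres_c) (use inv in auto)
  then have "invertible_mod T \<mu>"
    unfolding \<mu>_def using inv[of "n - 1"] n
    by (intro invertible_inverse_mod invertible_mod_mult invertible_mod_power invertible_mod_uminus) auto
  moreover have "subres T f1 f2 (Suc n) =
      reduce T (smult \<mu> (pseudo_mod (subres T f1 f2 (n - 1)) (subres T f1 f2 n)))"
    using n False by (subst subres.simps) (simp add: Let_def \<mu>_def)
  ultimately show thesis by (rule that)
qed

lemma subres_properties:
  fixes f1 f2 :: "'a::field poly poly"
  assumes T: "0 < degree T"
    and inv: "\<And>j. 1 \<le> j \<Longrightarrow> j \<le> n \<Longrightarrow> invertible_mod T (lead_coeff (subres T f1 f2 j))" and n: "2 \<le> n"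
  shows "ideal {subres T f1 f2 n, subres T f1 f2 (Suc n), [:T:]} = ideal {f1, f2, [:T:]}" (is ?A)
    and "subres T f1 f2 (Suc n) = 0 \<or> degree (subres T f1 f2 (Suc n)) < degree (subres T f1 f2 n)" (is ?B)
    and "degree (subres T f1 f2 n) + n \<le> degree f2 + 2" (is ?C)
    and "subres T f1 f2 (Suc n) \<noteq> 0 \<Longrightarrow> \<not> [:T:] dvd subres T f1 f2 (Suc n)"
proof -
  have next_remainder: "ideal {subres T f1 f2 (k - 1), subres T f1 f2 k, [:T:]}
      = ideal {subres T f1 f2 k, subres T f1 f2 (Suc k), [:T:]}"
    "subres T f1 f2 (Suc k) = 0 \<or> degree (subres T f1 f2 (Suc k)) < degree (subres T f1 f2 k)"
    "reduce T (subres T f1 f2 (Suc k)) = subres T f1 f2 (Suc k)"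
    if k: "2 \<le> k" "k \<le> n" for k
  proof -
    obtain \<mu> where \<mu>: "invertible_mod T \<mu>"
      "subres T f1 f2 (Suc k) = reduce T (smult \<mu> (pseudo_mod (subres T f1 f2 (k - 1)) (subres T f1 f2 k)))"
      using subres_Suc[OF inv k(1)] k(2) by auto
    have "invertible_mod T (lead_coeff (subres T f1 f2 k))"
      using inv k by simp
    note * = reduce_pseudo_mod[OF T this \<mu>]
    show "ideal {subres T f1 f2 (k - 1), subres T f1 f2 k, [:T:]}
        = ideal {subres T f1 f2 k, subres T f1 f2 (Suc k), [:T:]}"
      "subres T f1 f2 (Suc k) = 0 \<or> degree (subres T f1 f2 (Suc k)) < degree (subres T f1 f2 k)"
      by (fact *)+
    show "reduce T (subres T f1 f2 (Suc k)) = subres T f1 f2 (Suc k)"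
      unfolding \<mu>(2) by (simp add: poly_eq_iff coeff_reduce)
  qed
  have "ideal {subres T f1 f2 k, subres T f1 f2 (Suc k), [:T:]} = ideal {f1, f2, [:T:]} \<and>
      degree (subres T f1 f2 k) + k \<le> degree f2 + 2" if "2 \<le> k" "k \<le> n" for k
    using that
  proof (induction k rule: dec_induct)
    case base
    then show ?case
      using next_remainder(1)[of 2] by (simp add: subres_1 subres_2)
  next
    case (step k)
    have "subres T f1 f2 (Suc k) \<noteq> 0"
      using inv[of "Suc k"] step.prems not_invertible_mod_0[OF T] by auto
    then show ?case
      using step next_remainder(1)[of "Suc k"] next_remainder(2)[of k] by simp
  qed
  from this[OF n order_refl] show ?A ?C by auto
  show ?B using next_remainder(2) n by simp
  show "\<not> [:T:] dvd subres T f1 f2 (Suc n)" if "subres T f1 f2 (Suc n) \<noteq> 0"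
    using next_remainder(3)[OF n order_refl] that by (metis reduce_eq_0_iff)
qed

text \<open>
  The degrees decrease strictly, so the sequence reaches a leading coefficient (possibly that of \<open>0\<close>)
  which is not invertible.
\<close>
lemma subres_stop_properties:
  fixes f1 f2 :: "'a::field poly poly"
  assumes T: "0 < degree T" and f1: "invertible_mod T (lead_coeff f1)"
  defines "i \<equiv> subres_stop T f1 f2"
  shows "2 \<le> i" "\<not> invertible_mod T (lead_coeff (subres T f1 f2 i))"
    "\<And>j. 1 \<le> j \<Longrightarrow> j < i \<Longrightarrow> invertible_mod T (lead_coeff (subres T f1 f2 j))"
proof -
  define Q where "Q = (\<lambda>i. i \<ge> 2 \<and> \<not> invertible_mod T (lead_coeff (subres T f1 f2 i)))"
  have i: "i = (LEAST i. Q i)"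
    by (simp add: i_def subres_stop_def Q_def)
  have below: "invertible_mod T (lead_coeff (subres T f1 f2 j))" if "1 \<le> j" "\<not> Q j" for j
    using that f1 by (cases "j = 1") (auto simp: Q_def subres_1)
  have "\<exists>i. Q i"
  proof (rule ccontr)
    assume "\<not> (\<exists>i. Q i)"
    \<comment> \<open>From index 2 on the degrees drop at every step; at index \<open>degree f2 + 3\<close> they would be negative.\<close>
    then have "degree (subres T f1 f2 (degree f2 + 3)) + (degree f2 + 3) \<le> degree f2 + 2"
      by (intro subres_properties(3)[OF T]) (auto intro: below)
    then show False by simp
  qed
  then have "Q i"
    unfolding i by (rule LeastI_ex)
  then show "2 \<le> i" "\<not> invertible_mod T (lead_coeff (subres T f1 f2 i))"
    by (auto simp: Q_def)
  show "\<And>j. 1 \<le> j \<Longrightarrow> j < i \<Longrightarrow> invertible_mod T (lead_coeff (subres T f1 f2 j))"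
    by (rule below) (auto simp: i dest: not_less_Least)
qed


section \<open>The last non-nilpotent remainder\<close>

text \<open>
  In the recursive call the second argument is the monic associate of a remainder whose leading
  coefficient is not a unit, so its degree has dropped. As \<open>f2\<close> is not nilpotent, a result with
  \<open>U \<noteq> 1\<close> only arises from a proper remainder; this is why \<open>v\<close> has smaller degree than \<open>u\<close>.
\<close>
lemma last_non_nil_correct:
  fixes f1 f2 :: "'a::field poly poly"
  assumes p: "irreducible p" "lead_coeff p = 1" and e: "0 < e"
    and "invertible_mod (p ^ e) (lead_coeff f1)" "\<not> nilpotent_mod p f2"
  shows "\<exists>u v U T1. last_non_nil f1 f2 (p ^ e) = Some (u, v, U, T1) \<and>
    lead_coeff u = 1 \<and> degree u \<le> degree f2 \<and>
    (v = 0 \<and> ideal {f1, f2, [:p ^ e:]} = ideal {u, 0, [:p ^ e:]} \<or>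
     (\<exists>j. 0 < j \<and> j < e \<and> U = p ^ j \<and> T1 = p ^ (e - j) \<and> lead_coeff v = 1 \<and> degree v < degree u \<and>
        ideal {f1, f2, [:p ^ e:]} = ideal {u, [:p ^ j:] * v, [:p ^ e:]}))"
  using assms(4,5)
proof (induction "degree f2" arbitrary: f1 f2 rule: less_induct)
  case less
  let ?T = "p ^ e"
  have p0: "p \<noteq> 0" using p by auto
  have degp: "0 < degree (p ^ k) \<longleftrightarrow> 0 < k" for k
    using p0 degree_irreducible[OF p(1)] by (simp add: degree_power_eq)
  then have T: "0 < degree ?T" using e by simp
  have f2: "\<not> [:p:] dvd f2"
    using less.prems(2) by (simp add: nilpotent_mod_def const_poly_dvd_iff)
  have dvd_pow: "[:p:] dvd [:p ^ k:]" if "0 < k" for k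
    using that by (auto intro: dvd_power)
  define i where "i = subres_stop ?T f1 f2"
  define A where "A = subres ?T f1 f2 (i - 1)"
  define F where "F = subres ?T f1 f2 i"
  note stop = subres_stop_properties[OF T less.prems(1), where ?f2.0 = f2, folded i_def]
  have A: "invertible_mod ?T (lead_coeff A)"
    unfolding A_def using stop by auto
  have notinv: "\<not> invertible_mod ?T (lead_coeff F)"
    unfolding F_def by (rule stop(2))
  have "ideal {A, F, [:?T:]} = ideal {f1, f2, [:?T:]} \<and>
    (i \<noteq> 2 \<longrightarrow> degree A \<le> degree f2 \<and> (F = 0 \<or> degree F < degree A)) \<and>
    (F \<noteq> 0 \<longrightarrow> degree F \<le> degree f2 \<and> \<not> [:?T:] dvd F) \<and> (i = 2 \<longrightarrow> F = f2)"
  proof (cases "i = 2")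
    case True
    moreover have "\<not> [:?T:] dvd f2"
      using f2 dvd_pow[OF e] dvd_trans by blast
    ultimately show ?thesis
      by (simp add: A_def F_def subres_1 subres_2)
  next
    case False
    then have n: "2 \<le> i - 1" "Suc (i - 1) = i" using stop(1) by auto
    have "invertible_mod ?T (lead_coeff (subres ?T f1 f2 j))" if "1 \<le> j" "j \<le> i - 1" for j
      using stop(3) that n by auto
    note props = subres_properties[OF T this n(1), unfolded n(2), folded A_def F_def]
    show ?thesis
      using props n(1) False by auto
  qed
  then have id: "ideal {f1, f2, [:?T:]} = ideal {A, F, [:?T:]}"
    and degA: "i \<noteq> 2 \<Longrightarrow> degree A \<le> degree f2" "i \<noteq> 2 \<Longrightarrow> F = 0 \<or> degree F < degree A"
    and F: "F \<noteq> 0 \<Longrightarrow> degree F \<le> degree f2" "F \<noteq> 0 \<Longrightarrow> \<not> [:?T:] dvd F" "i = 2 \<Longrightarrow> F = f2"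
    by auto
  define a where "a = make_monic_mod ?T A"
  have a: "lead_coeff a = 1" "degree a = degree A"
    unfolding a_def using make_monic_mod[OF T A] by simp_all
  have id_a: "ideal {f1, f2, [:?T:]} = ideal {a, F, [:?T:]}"
    unfolding id a_def by (rule ideal3_make_monic[OF A])
  have unfold: "last_non_nil f1 f2 ?T = (if F = 0 then Some (a, 0, 1, ?T)
      else let (b, U) = monic_form F ?T
        in if degree U > 0 then Some (a, b, U, ?T div U) else last_non_nil a b ?T)"
    by (subst last_non_nil.simps) (simp only: Let_def F_def A_def a_def i_def)
  show ?case
  proof (cases "F = 0")
    case True
    then have "i \<noteq> 2" using F(3) f2 by auto
    then show ?thesis
      using True unfold a degA(1) id_a by simp
  next
    case False
    from monic_form_correct[OF p F(2)[OF False]] obtain j b g w where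
      b: "monic_form F ?T = (b, p ^ j)" "j < e" "[:p ^ j:] dvd F"
      "lead_coeff b = 1" "degree b \<le> degree F"
      "j = 0 \<Longrightarrow> \<not> invertible_mod ?T (lead_coeff F) \<Longrightarrow> degree b < degree F"
      "[:?T:] dvd F - g * ([:p ^ j:] * b)" "[:?T:] dvd [:p ^ j:] * b - w * F"
      by metis
    have id_b: "ideal {f1, f2, [:?T:]} = ideal {a, [:p ^ j:] * b, [:?T:]}"
      unfolding id_a by (rule ideal3_associated[OF b(7,8)])
    show ?thesis
    proof (cases "j = 0")
      case True
      have lt: "degree b < degree f2"
        using b(6)[OF True notinv] F(1)[OF False] by simp
      have nonnil_b: "\<not> nilpotent_mod p b"
        using b(4) p(1) unfolding nilpotent_mod_def by (metis irreducible_not_unit)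
      have inv_a: "invertible_mod ?T (lead_coeff a)"
        using a(1) by (simp add: invertible_mod_one)
      obtain u v U T1 where IH: "last_non_nil a b ?T = Some (u, v, U, T1)"
        "lead_coeff u = 1" "degree u \<le> degree b"
        "v = 0 \<and> ideal {a, b, [:?T:]} = ideal {u, 0, [:?T:]} \<or>
         (\<exists>j. 0 < j \<and> j < e \<and> U = p ^ j \<and> T1 = p ^ (e - j) \<and> lead_coeff v = 1 \<and> degree v < degree u \<and>
           ideal {a, b, [:?T:]} = ideal {u, [:p ^ j:] * v, [:?T:]})"
        using less.hyps[OF lt inv_a nonnil_b] by (elim exE conjE) (rule that)
      have "last_non_nil f1 f2 ?T = last_non_nil a b ?T"
        using unfold False b(1) True by simp
      moreover have "ideal {f1, f2, [:?T:]} = ideal {a, b, [:?T:]}"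
        using id_b True by simp
      moreover have "degree u \<le> degree f2"
        using IH(3) lt by simp
      ultimately show ?thesis
        using IH by (intro exI[of _ u] exI[of _ v] exI[of _ U] exI[of _ T1]) simp
    next
      case j: False
      have "i \<noteq> 2"
        using F(3) f2 b(3) dvd_trans[OF dvd_pow[of j] b(3)] j by blast
      then have "degree a \<le> degree f2" "degree b < degree a"
        using degA False b(5) a(2) by auto
      moreover have "?T = p ^ j * p ^ (e - j)"
        using b(2) by (simp flip: power_add)
      then have "?T div p ^ j = p ^ (e - j)"
        using p0 by simp
      then have "last_non_nil f1 f2 ?T = Some (a, b, p ^ j, p ^ (e - j))"
        using unfold False b(1) j degp by simp
      ultimately show ?thesis
        using a(1) b(2,4) id_b j by blast
    qed
  qed
qed


section \<open>Staircase bases\<close>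

text \<open>
  A Groebner basis given by its staircase: along the list the leading exponents decrease strictly
  in \<open>y\<close> and increase strictly in \<open>x\<close>. The leading monomial of \<open>f\<close> has the exponent
  \<open>(degree (lead_coeff f), degree f)\<close>, so the last clause says that every leading monomial of the
  ideal is divisible by one of the list.
\<close>
definition staircase_basis :: "'a::field poly poly list \<Rightarrow> 'a poly poly set \<Rightarrow> bool" where
  "staircase_basis G I \<longleftrightarrow> set G \<subseteq> I \<and> (\<forall>g\<in>set G. lead_coeff (lead_coeff g) = 1) \<and>
     sorted_wrt (\<lambda>g h. degree h < degree g \<and> degree (lead_coeff g) < degree (lead_coeff h)) G \<and>
     (\<forall>f\<in>I. f \<noteq> 0 \<longrightarrow> (\<exists>g\<in>set G. degree g \<le> degree f \<and> degree (lead_coeff g) \<le> degree (lead_coeff f)))"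

lemma lead_monom_dvd_iff:
  fixes f g :: "'a::field poly poly"
  assumes "f \<noteq> 0" "g \<noteq> 0"
  shows "lead_monom g dvd lead_monom f \<longleftrightarrow>
    degree g \<le> degree f \<and> degree (lead_coeff g) \<le> degree (lead_coeff f)"
proof
  assume "lead_monom g dvd lead_monom f"
  then obtain q where "lead_monom f = lead_monom g * q"
    by blast
  then have q: "monom (monom 1 (degree (lead_coeff f))) (degree f)
      = monom (monom 1 (degree (lead_coeff g))) (degree g) * q"
    using assms by (simp add: lead_monom_def lead_exp_eq)
  then have "q \<noteq> 0"
    by (metis monom_eq_0_iff mult_zero_right one_neq_zero)
  then have "degree f = degree g + degree q"
    using arg_cong[OF q, of degree] by (simp add: degree_mult_eq degree_monom_eq)
  moreover have "monom 1 (degree (lead_coeff f)) = monom 1 (degree (lead_coeff g)) * lead_coeff q"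
    using arg_cong[OF q, of lead_coeff] by (simp add: lead_coeff_mult degree_monom_eq)
  then have "degree (lead_coeff f) = degree (lead_coeff g) + degree (lead_coeff q)"
    using \<open>q \<noteq> 0\<close> by (metis degree_monom_eq degree_mult_eq leading_coeff_0_iff monom_eq_0_iff one_neq_zero)
  ultimately show "degree g \<le> degree f \<and> degree (lead_coeff g) \<le> degree (lead_coeff f)"
    by simp
next
  assume "degree g \<le> degree f \<and> degree (lead_coeff g) \<le> degree (lead_coeff f)"
  then have "lead_monom f = lead_monom g *
      monom (monom 1 (degree (lead_coeff f) - degree (lead_coeff g))) (degree f - degree g)"
    using assms by (simp add: lead_monom_def lead_exp_eq mult_monom)
  then show "lead_monom g dvd lead_monom f"
    by simp
qed

lemma staircase_basis_minimal_groebner: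
  assumes "staircase_basis G I"
  shows "minimal_lex_groebner_basis G I"
proof -
  have G: "set G \<subseteq> I" "\<And>g. g \<in> set G \<Longrightarrow> lead_coeff (lead_coeff g) = 1"
    and sorted: "sorted_wrt (\<lambda>g h. degree h < degree g \<and> degree (lead_coeff g) < degree (lead_coeff h)) G"
    and div: "\<And>f. f \<in> I \<Longrightarrow> f \<noteq> 0 \<Longrightarrow>
      \<exists>g\<in>set G. degree g \<le> degree f \<and> degree (lead_coeff g) \<le> degree (lead_coeff f)"
    using assms unfolding staircase_basis_def by blast+
  have G0: "g \<noteq> 0" if "g \<in> set G" for g
    using G(2)[OF that] by auto
  have "lead_monom ` (I - {0}) \<subseteq> ideal (lead_monom ` (set G - {0}))"
  proof
    fix m assume "m \<in> lead_monom ` (I - {0})"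
    then obtain f where f: "f \<in> I" "f \<noteq> 0" "m = lead_monom f"
      by blast
    then obtain g where g: "g \<in> set G" "degree g \<le> degree f" "degree (lead_coeff g) \<le> degree (lead_coeff f)"
      using div by blast
    then have "lead_monom g dvd lead_monom f"
      using lead_monom_dvd_iff[OF f(2) G0] by simp
    then obtain q where "lead_monom f = q * lead_monom g"
      by (metis dvd_def mult.commute)
    moreover have "lead_monom g \<in> ideal (lead_monom ` (set G - {0}))"
      using g(1) G0 by (intro ideal_generator) auto
    ultimately show "m \<in> ideal (lead_monom ` (set G - {0}))"
      by (simp add: f(3) ideal_mult)
  qed
  moreover have "lead_monom ` (set G - {0}) \<subseteq> ideal (lead_monom ` (I - {0}))"
    using G(1) by (auto intro: ideal_generator)
  ultimately have "lex_groebner_basis (set G) I"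
    unfolding lex_groebner_basis_def using G(1) by (intro conjI antisym ideal_subset) simp_all
  moreover have "lex_lead_coeff g = 1" if "g \<in> set G" for g
    using G(2)[OF that] lead_exp_eq[OF G0[OF that]] by (simp add: lex_lead_coeff_def)
  moreover have "\<not> lead_monom (G ! j) dvd lead_monom (G ! i)"
    if "i < length G" "j < length G" "j \<noteq> i" for i j
  proof -
    have "G ! i \<noteq> 0" "G ! j \<noteq> 0"
      using that G0 by simp_all
    moreover have "i < j \<or> j < i" using that by auto
    ultimately show ?thesis
      using sorted_wrt_nth_less[OF sorted, of i j] sorted_wrt_nth_less[OF sorted, of j i] that
      by (auto simp: lead_monom_dvd_iff)
  qed
  ultimately show ?thesis
    unfolding minimal_lex_groebner_basis_def using G0 by blast
qed

text \<open>
  Replacing \<open>j\<close> by its remainder modulo \<open>u\<close> makes the coefficient of \<open>u\<close> vanish for degree reasons.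
\<close>
lemma small_degree_combination:
  fixes f u :: "'r::idom poly"
  assumes u: "lead_coeff u = 1" and f: "f = q * u + [:c:] * j" "degree f < degree u"
  shows "\<exists>q'. f = [:c:] * (j - q' * u)"
proof -
  obtain q' r where qr: "pseudo_divmod j u = (q', r)" by fastforce
  note d = monic_pseudo_divmod[OF u qr]
  have "u * (q + [:c:] * q') = f - [:c:] * r"
    unfolding f(1) d(1) by (simp add: algebra_simps smult_add_right)
  moreover have "degree (f - [:c:] * r) < degree u"
    using f(2) d(2) degree_smult_le[of c r] by (auto intro!: degree_diff_less)
  ultimately have "q + [:c:] * q' = 0"
    using monic_mult_small_degree[OF u] by blast
  then have "f - [:c:] * r = 0"
    using \<open>u * (q + [:c:] * q') = f - [:c:] * r\<close> by simp
  then have "f = [:c:] * (j - q' * u)"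
    unfolding d(1) by (simp add: algebra_simps)
  then show ?thesis by blast
qed

lemma staircase_basis_unit:
  assumes "1 \<in> I"
  shows "staircase_basis [1] I"
  using assms by (simp add: staircase_basis_def)

lemma staircase_basis_monic:
  fixes u :: "'a::field poly poly"
  assumes u: "lead_coeff u = 1" "0 < degree u" and T: "lead_coeff T = 1" "0 < degree T"
  shows "staircase_basis [u, [:T:]] (ideal {u, 0, [:T:]})"
  unfolding staircase_basis_def
proof (intro conjI ballI impI)
  fix f assume "f \<in> ideal {u, 0, [:T:]}" "f \<noteq> 0"
  then obtain q s where f: "f = q * u + [:T:] * s"
    unfolding mem_ideal3 by (auto simp: mult.commute)
  show "\<exists>g\<in>set [u, [:T:]]. degree g \<le> degree f \<and> degree (lead_coeff g) \<le> degree (lead_coeff f)"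
  proof (cases "degree f < degree u")
    case True
    then obtain q' where f': "f = [:T:] * (s - q' * u)"
      using small_degree_combination[OF u(1) f] by blast
    then have "T dvd lead_coeff f"
      by (simp add: lead_coeff_mult)
    then have "degree T \<le> degree (lead_coeff f)"
      using \<open>f \<noteq> 0\<close> by (intro dvd_imp_degree_le) auto
    then show ?thesis by simp
  qed (use u in auto)
qed (use u T in \<open>auto intro: ideal_generator\<close>)

text \<open>
  An element of \<open>\<langle>u\<rangle> + U J\<close> of degree less than that of \<open>u\<close> lies in \<open>U J\<close>, because \<open>u \<in> J\<close>. So its
  leading monomial is that of \<open>U\<close> times a leading monomial of \<open>J\<close>.
\<close>
lemma staircase_basis_Cons:
  fixes u v :: "'a::field poly poly"
  assumes u: "lead_coeff u = 1" and U: "lead_coeff U = 1" "0 < degree U"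
    and G: "staircase_basis G (ideal {u, v, [:T:]})" "\<And>g. g \<in> set G \<Longrightarrow> degree g < degree u"
  shows "staircase_basis (u # map (smult U) G) (ideal {u, [:U:] * v, [:U * T:]})"
proof -
  let ?J = "ideal {u, v, [:T:]}" and ?I = "ideal {u, [:U:] * v, [:U * T:]}"
  have U0: "U \<noteq> 0" using U by auto
  have G1: "set G \<subseteq> ?J" "\<And>g. g \<in> set G \<Longrightarrow> lead_coeff (lead_coeff g) = 1"
    and sorted: "sorted_wrt (\<lambda>g h. degree h < degree g \<and> degree (lead_coeff g) < degree (lead_coeff h)) G"
    and div: "\<And>f. f \<in> ?J \<Longrightarrow> f \<noteq> 0 \<Longrightarrow>
      \<exists>g\<in>set G. degree g \<le> degree f \<and> degree (lead_coeff g) \<le> degree (lead_coeff f)"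
    using G(1) unfolding staircase_basis_def by blast+
  have deg: "degree (lead_coeff (smult U g)) = degree U + degree (lead_coeff g)" if "g \<noteq> 0" for g
    using that U0 by (simp add: degree_mult_eq)
  have G0: "g \<noteq> 0" if "g \<in> set G" for g
    using G1(2)[OF that] by auto
  have mem: "smult U g \<in> ?I" if g: "g \<in> ?J" for g
  proof -
    obtain q r s where "g = q * u + r * v + s * [:T:]"
      using g unfolding mem_ideal3 by blast
    then have "smult U g = ([:U:] * q) * u + r * ([:U:] * v) + s * [:U * T:]"
      by (simp add: smult_add_right mult.commute)
    then show ?thesis
      unfolding mem_ideal3 by blast
  qed
  have "\<exists>g\<in>set (u # map (smult U) G). degree g \<le> degree f \<and> degree (lead_coeff g) \<le> degree (lead_coeff f)"
    if f_mem: "f \<in> ?I" "f \<noteq> 0" for f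
  proof (cases "degree f < degree u")
    case True
    obtain q r s where "f = q * u + r * ([:U:] * v) + s * [:U * T:]"
      using f_mem(1) unfolding mem_ideal3 by blast
    then have f: "f = q * u + [:U:] * (r * v + s * [:T:])"
      by (simp add: smult_add_right mult.commute)
    obtain q' where f': "f = [:U:] * (r * v + s * [:T:] - q' * u)"
      using small_degree_combination[OF u f True] by blast
    define h where "h = r * v + s * [:T:] - q' * u"
    have h: "f = smult U h" "h \<noteq> 0"
      using f' f_mem(2) by (auto simp: h_def)
    have "h = (- q') * u + r * v + s * [:T:]"
      by (simp add: h_def)
    then have "h \<in> ?J"
      unfolding mem_ideal3 by blast
    then obtain g where g: "g \<in> set G" "degree g \<le> degree h" "degree (lead_coeff g) \<le> degree (lead_coeff h)"
      using div h(2) by blast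
    then have "degree (smult U g) \<le> degree f \<and> degree (lead_coeff (smult U g)) \<le> degree (lead_coeff f)"
      using deg[OF G0[OF g(1)]] deg[OF h(2)] U0 unfolding h(1) by simp
    then show ?thesis
      using g(1) by auto
  qed (use u in auto)
  moreover have "sorted_wrt (\<lambda>g h. degree h < degree g \<and> degree (lead_coeff g) < degree (lead_coeff h))
      (u # map (smult U) G)"
  proof -
    have "sorted_wrt (\<lambda>g h. degree (smult U h) < degree (smult U g) \<and>
        degree (lead_coeff (smult U g)) < degree (lead_coeff (smult U h))) G"
      by (rule sorted_wrt_mono_rel[OF _ sorted]) (use deg G0 U0 in auto)
    moreover have "degree (smult U g) < degree u \<and> degree (lead_coeff u) < degree (lead_coeff (smult U g))"
      if "g \<in> set G" for g
      using G(2)[OF that] deg[OF G0[OF that]] U U0 u by simp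
    ultimately show ?thesis
      by (simp only: sorted_wrt.simps sorted_wrt_map set_map) auto
  qed
  moreover have "lead_coeff (lead_coeff (smult U g)) = 1" if "g \<in> set G" for g
    using G1(2)[OF that] U U0 by (simp add: lead_coeff_mult)
  ultimately show ?thesis
    unfolding staircase_basis_def using G1(1) mem u by (auto intro: ideal_generator)
qed


section \<open>Correctness of the algorithm\<close>

text \<open>
  The degree bound passes through the recursion: the basis computed from \<open>u\<close> and \<open>v\<close> has degrees at
  most that of \<open>v\<close>, hence below that of \<open>u\<close>, which is the condition for prepending \<open>u\<close>.
\<close>
lemma subres_to_gb_staircase:
  fixes a b :: "'a::field poly poly"
  assumes p: "irreducible p" "lead_coeff p = 1" and "0 < e"
    and "invertible_mod (p ^ e) (lead_coeff a)" "\<not> nilpotent_mod p b"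
  shows "\<exists>G. subres_to_gb a b (p ^ e) = Some G \<and> staircase_basis G (ideal {a, b, [:p ^ e:]}) \<and>
    (\<forall>g\<in>set G. degree g \<le> degree b)"
  using assms(3-)
proof (induction e arbitrary: a b rule: less_induct)
  case (less e)
  let ?T = "p ^ e"
  have degp: "0 < degree (p ^ k)" if "0 < k" for k
    using p that degree_irreducible[OF p(1)] by (subst degree_power_eq) auto
  have lp: "lead_coeff (p ^ k) = 1" for k
    using p(2) by (simp add: lead_coeff_power)
  note T = degp[OF less.prems(1)]
  define a' where "a' = reduce ?T a"
  define b' where "b' = reduce ?T b"
  have id: "ideal {a, b, [:?T:]} = ideal {a', b', [:?T:]}"
    unfolding a'_def b'_def by (rule ideal3_reduce[symmetric])
  have unfold: "subres_to_gb a b ?T =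
      (if nonzero_constant a' \<or> nonzero_constant b' then Some [1]
        else Option.bind (last_non_nil a' b' ?T) (\<lambda>(u, v, U, T1).
          if u = 1 then Some [1]
          else if v = 0 then Some [u, [:?T:]]
          else Option.bind (subres_to_gb u v T1) (\<lambda>gs. Some (u # map (smult U) gs))))"
    by (subst subres_to_gb.simps) (simp add: Let_def a'_def b'_def)
  have unit: ?case if "1 \<in> ideal {a, b, [:?T:]}" "subres_to_gb a b ?T = Some [1]"
    using that staircase_basis_unit by auto
  show ?case
  proof (cases "nonzero_constant a' \<or> nonzero_constant b'")
    case True
    then obtain c x where c: "c \<noteq> 0" "x = [:[:c:]:]" "x \<in> {a', b'}"
      unfolding nonzero_constant_def by blast
    then have "1 = [:[:inverse c:]:] * x"
      by (simp add: one_pCons)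
    moreover have "x \<in> ideal {a', b', [:?T:]}"
      using c(3) by (auto intro: ideal_generator)
    ultimately have "1 \<in> ideal {a, b, [:?T:]}"
      unfolding id using ideal_mult by metis
    then show ?thesis
      using unit unfold True by simp
  next
    case False
    have inv: "invertible_mod ?T (lead_coeff a')"
      unfolding a'_def by (rule invertible_lead_coeff_reduce[OF T less.prems(2)])
    have nonnil: "\<not> nilpotent_mod p b'"
    proof -
      have "p dvd ?T" using less.prems(1) by (intro dvd_power) simp
      then have "p dvd coeff b i mod ?T \<longleftrightarrow> p dvd coeff b i" for i
        by (rule dvd_mod_iff)
      then show ?thesis
        using less.prems(3) by (simp add: nilpotent_mod_def b'_def coeff_reduce)
    qed
    obtain u v U T1 where lnn: "last_non_nil a' b' ?T = Some (u, v, U, T1)"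
      and u: "lead_coeff u = 1" "degree u \<le> degree b'"
      and v: "v = 0 \<and> ideal {a', b', [:?T:]} = ideal {u, 0, [:?T:]} \<or>
       (\<exists>j. 0 < j \<and> j < e \<and> U = p ^ j \<and> T1 = p ^ (e - j) \<and> lead_coeff v = 1 \<and> degree v < degree u \<and>
        ideal {a', b', [:?T:]} = ideal {u, [:p ^ j:] * v, [:?T:]})"
      using last_non_nil_correct[OF p less.prems(1) inv nonnil] by (elim exE conjE) (rule that)
    have degu: "degree u \<le> degree b"
      using u(2) degree_reduce_le[of ?T b] unfolding b'_def by simp
    note unfold = unfold[simplified lnn if_not_P[OF False] Option.bind.bind_lunit prod.case]
    show ?thesis
    proof (cases "u = 1")
      case True
      have "u \<in> ideal {a, b, [:?T:]}"
        using v unfolding id by (auto intro: ideal_generator)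
      then show ?thesis
        using unit unfold True by simp
    next
      case u1: False
      have degu0: "0 < degree u"
      proof (rule ccontr)
        assume "\<not> 0 < degree u"
        then have "u = [:lead_coeff u:]"
          by (auto elim: degree_eq_zeroE)
        then show False
          using u(1) u1 by (simp add: one_pCons)
      qed
      show ?thesis
      proof (cases "v = 0")
        case True
        then have "ideal {a, b, [:?T:]} = ideal {u, 0, [:?T:]}"
          using v id by auto
        then show ?thesis
          using unfold u1 True degu staircase_basis_monic[OF u(1) degu0 lp T] by simp
      next
        case v0: False
        then obtain j where j: "0 < j" "j < e" "U = p ^ j" "T1 = p ^ (e - j)"
          and lv: "lead_coeff v = 1" "degree v < degree u"
          and id': "ideal {a', b', [:?T:]} = ideal {u, [:p ^ j:] * v, [:?T:]}"
          using v by blast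
        have "e - j < e" "0 < e - j" using j by auto
        moreover have "invertible_mod (p ^ (e - j)) (lead_coeff u)"
          using u(1) by (simp add: invertible_mod_one)
        moreover have "\<not> nilpotent_mod p v"
          using lv(1) p(1) unfolding nilpotent_mod_def by (metis irreducible_not_unit)
        ultimately obtain G where G: "subres_to_gb u v (p ^ (e - j)) = Some G"
          "staircase_basis G (ideal {u, v, [:p ^ (e - j):]})" "\<forall>g\<in>set G. degree g \<le> degree v"
          using less.IH by blast
        have "staircase_basis (u # map (smult (p ^ j)) G)
            (ideal {u, [:p ^ j:] * v, [:p ^ j * p ^ (e - j):]})"
          by (rule staircase_basis_Cons[OF u(1) lp degp[OF j(1)] G(2)]) (use G(3) lv(2) in force)
        moreover have "p ^ j * p ^ (e - j) = ?T"
          using j(2) by (simp flip: power_add)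
        moreover have "\<forall>g\<in>set (u # map (smult (p ^ j)) G). degree g \<le> degree b"
          using G(3) lv(2) degu degree_smult_le[of "p ^ j"] by (force intro: order_trans)
        moreover have "subres_to_gb a b ?T = Some (u # map (smult (p ^ j)) G)"
          using unfold u1 v0 j G(1) by simp
        ultimately show ?thesis
          using id id' by auto
      qed
    qed
  qed
qed

theorem theorem3:
  fixes a b :: "'a::field poly poly" and p T :: "'a poly" and e :: nat
  assumes "perfect_field TYPE('a)"
    and "irreducible p" and "T = p ^ e" and "lead_coeff T = 1" and "degree T > 0"
    and "degree b \<le> degree a"
    and "invertible_mod T (lead_coeff a)"
    and "\<not> nilpotent_mod p b"
  shows "\<exists>G. subres_to_gb a b T = Some G \<and>
             minimal_lex_groebner_basis G (ideal {a, b, [:T:]})"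
proof -
  have p0: "p \<noteq> 0" using assms(2) by auto
  have e: "0 < e" using assms(3,5) by (cases e) auto
  \<comment> \<open>The monic associate of \<open>p\<close> has the same power, because \<open>T\<close> is monic.\<close>
  define c where "c = inverse (lead_coeff p)"
  define q where "q = smult c p"
  have c: "c \<noteq> 0" using p0 by (simp add: c_def)
  have q: "lead_coeff q = 1"
    using p0 by (simp add: q_def c_def)
  have q_dvd: "q dvd x \<longleftrightarrow> p dvd x" for x
    using c by (simp add: q_def smult_dvd_iff)
  have "irreducible q"
    using assms(2) irreducible_mult_unit_left[of "[:c:]" p] c by (simp add: q_def is_unit_pCons_iff)
  have "c ^ e = 1"
    using assms(3,4) by (simp add: c_def lead_coeff_power power_inverse)
  then have "T = q ^ e"
    using assms(3) by (simp add: q_def smult_power)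
  moreover have "\<not> nilpotent_mod q b"
    using assms(8) by (simp add: nilpotent_mod_def q_dvd)
  ultimately show ?thesis
    using subres_to_gb_staircase[OF \<open>irreducible q\<close> q e, of a b] assms(7)
      staircase_basis_minimal_groebner by blast
qed

end
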